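(* Let $V\in C^1(\mathbb{R})$ be a complex-valued periodic function of period $\pi$. Then for every $x\in\mathbb{R}$, $$V(x)=2\nu_0(x)-E_0+\sum_{m=1}^{\infty}\big(2\nu_m(x)-E_{2m-1}-E_{2m}\big).$$
   Context: For $\lambda\in\mathbb{C}$ and $x_0\in\mathbb{R}$, let $c(\lambda,x_0,\cdot)$ and $s(\lambda,x_0,\cdot)$ be the solutions of $-\psi''(x)+V(x)\psi(x)=\lambda\psi(x)$ on $\mathbb{R}$ with $c(\lambda,x_0,x_0)=1$, $c'(\lambda,x_0,x_0)=0$, $s(\lambda,x_0,x_0)=0$, $s'(\lambda,x_0,x_0)=1$, where $'$ denotes the derivative in the last variable. The Floquet discriminant is $\Delta(\lambda)=\tfrac12\big(c(\lambda,x_0,x_0+\pi)+s'(\lambda,x_0,x_0+\pi)\big)$ (independent of $x_0$). The numbers $E_m$, $m\in\mathbb{N}_0$, are the zeros of the entire function $\Delta(\lambda)^2-1$ (equivalently, the eigenvalues of $-d^2/dx^2+V$ with periodic boundary conditions at $0$ and $2\pi$). The Neumann eigenvalues $\nu_k(x)$, $k\in\mathbb{N}_0$, are the eigenvalues of $-d^2/dt^2+V$ on $[x,x+\pi]$ with boundary conditions $f'(x)=0=f'(x+\pi)$, i.e. the zeros of the entire function $\lambda\mapsto c'(\lambda,x,x+\pi)$. Both sequences are listed with multiplicity and numbered in order of non-decreasing modulus. *)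

theory Defs
  imports "HOL-Complex_Analysis.Complex_Analysis"
begin

definition is_sol :: "(real \<Rightarrow> complex) \<Rightarrow> complex \<Rightarrow> (real \<Rightarrow> complex) \<Rightarrow> bool" where
  "is_sol V lam f \<longleftrightarrow>
     (\<forall>t. f differentiable (at t)) \<and>
     (\<forall>t. ((\<lambda>u. vector_derivative f (at u)) has_vector_derivative
              ((V t - lam) * f t)) (at t))"

definition csol :: "(real \<Rightarrow> complex) \<Rightarrow> complex \<Rightarrow> real \<Rightarrow> real \<Rightarrow> complex" where
  "csol V lam x0 = (THE f. is_sol V lam f \<and> f x0 = 1 \<and> vector_derivative f (at x0) = 0)"

definition ssol :: "(real \<Rightarrow> complex) \<Rightarrow> complex \<Rightarrow> real \<Rightarrow> real \<Rightarrow> complex" where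
  "ssol V lam x0 = (THE f. is_sol V lam f \<and> f x0 = 0 \<and> vector_derivative f (at x0) = 1)"

definition discr :: "(real \<Rightarrow> complex) \<Rightarrow> complex \<Rightarrow> complex" where
  "discr V lam = (csol V lam 0 pi + vector_derivative (ssol V lam 0) (at pi)) / 2"

text \<open>The entire function lam |-> c'(lam,x,x+pi), whose zeros are the Neumann eigenvalues.\<close>
definition neumann_fun :: "(real \<Rightarrow> complex) \<Rightarrow> real \<Rightarrow> complex \<Rightarrow> complex" where
  "neumann_fun V x lam = vector_derivative (csol V lam x) (at (x + pi))"

definition zeros_enum :: "(complex \<Rightarrow> complex) \<Rightarrow> (nat \<Rightarrow> complex) \<Rightarrow> bool" where
  "zeros_enum F z \<longleftrightarrow>
     mono (\<lambda>m. norm (z m)) \<and>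
     (\<forall>w. card {m. z m = w} = (if F w = 0 then nat (zorder F w) else 0))"

end

theory Submission
  imports Defs
begin

text \<open>
  Fix the base point \<open>x\<close> and put \<open>W t = V (t + x)\<close>. With \<open>d = s' - c\<close> and
  \<open>h = c' + (\<lambda> - W) s\<close> one has \<open>d' = - h\<close> and \<open>d'' = (W - \<lambda>) d + W' s\<close>, with zero initial values,
  so \<open>d\<close> and \<open>h\<close> are small compared with \<open>c'\<close> for large \<open>\<lambda>\<close>; for \<open>h\<close> this uses \<open>W \<pi> = W 0\<close>
  and the Riemann-Lebesgue lemma. Write \<open>N = c'(\<pi>)\<close> for the Neumann function and \<open>D = \<Delta>\<^sup>2 - 1\<close>.
  The Wronskian identity gives \<open>4 D = d(\<pi>)\<^sup>2 + 4 N s(\<pi>)\<close>, whence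
  \<open>(\<lambda> - V x) D / (- N\<^sup>2) = 1 + o(1/\<lambda>)\<close> uniformly on the circles \<open>\<bar>\<lambda>\<bar> = (n + 1/2)\<^sup>2\<close>. By the argument
  principle the zeros of \<open>(\<lambda> - V x) D\<close> and of \<open>N\<^sup>2\<close> inside these circles agree in number, and their
  sums differ by \<open>o(1)\<close>; this is the trace formula. Comparison with \<open>V = 0\<close> shows that exactly
  \<open>n + 1\<close> zeros of \<open>N\<close> lie inside the \<open>n\<close>-th circle, so that the partial sums of the numbered zeros
  are sums over discs.
\<close>

subsection \<open>Linear second-order equations\<close>

text \<open>The difference of the zero sums is a contour integral over a circle of length 2 pi R, so
  the quotient has to be 1 + o(1/R) there; an error O(1/R) would not do. With lambda = k^2, N has
  size |k| exp(|Im k| pi) on the circles and d is smaller by a factor of order |k|^-3, so its share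
  is harmless. The critical term is h / N: estimating h by absolute values gives only O(1/R). The
  leading part of h(pi) is, up to sign, the integral of W'(u) cos(k(pi - u)) sin(k u) / k, whose
  non-oscillating half is a multiple of the mean of W'. This is how one derivative of V and
  periodicity produce the missing o(1). The factor lambda - V x has two tasks: it supplies the one
  zero by which D falls short of N^2, and that zero contributes the left-hand side of the formula.
  The radii are chosen because |k| = n + 1/2 keeps k pi off the zeros of the sine. Each further
  circle captures exactly one more nu and two more E, so every late partial sum of the series is a
  combination of disc sums, and convergence needs no passage to a subsequence.\<close>

lemma antiderivative_exists:
  fixes f :: "real \<Rightarrow> complex"
  assumes "continuous_on UNIV f"
  shows "\<exists>F. F 0 = 0 \<and> (\<forall>t. (F has_vector_derivative f t) (at t))"
proof -
  have "\<exists>F. \<forall>x::real. -\<infinity> < ereal x \<longrightarrow> ereal x < \<infinity> \<longrightarrow> (F has_vector_derivative f x) (at x)"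
    using assms by (intro einterval_antiderivative) (auto simp: continuous_on_eq_continuous_at)
  then obtain F where F: "\<And>t. (F has_vector_derivative f t) (at t)" by auto
  have "((\<lambda>t. F t - F 0) has_vector_derivative f t) (at t)" for t
    using F[of t] by (auto intro!: derivative_eq_intros)
  then show ?thesis by (intro exI[of _ "\<lambda>t. F t - F 0"]) auto
qed

definition antider :: "(real \<Rightarrow> complex) \<Rightarrow> real \<Rightarrow> complex" where
  "antider f = (SOME F. F 0 = 0 \<and> (\<forall>t. (F has_vector_derivative f t) (at t)))"

lemma antider:
  assumes "continuous_on UNIV f"
  shows "antider f 0 = 0" "(antider f has_vector_derivative f t) (at t)"
  using someI_ex[OF antiderivative_exists[OF assms]] unfolding antider_def by auto

lemma has_vector_derivative_reflect:
  assumes "(f has_vector_derivative d) (at (- t))"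
  shows "((\<lambda>t. f (- t)) has_vector_derivative - d) (at (t::real))"
  using vector_diff_chain_at[of uminus "-1" t f d] assms
    has_vector_derivative_minus[OF has_vector_derivative_id, of "at t"]
  by (simp add: o_def)

text \<open>One step of the factorial estimate for Picard terms: integration raises the power of |t|
  and divides by the new exponent. Negative t is reduced to positive t by reflection.\<close>

lemma antiderivative_power_bound:
  fixes f F :: "real \<Rightarrow> complex"
  assumes F: "F 0 = 0" "\<And>t. (F has_vector_derivative f t) (at t)"
    and b: "\<And>t. \<bar>t\<bar> \<le> T \<Longrightarrow> norm (f t) \<le> C * \<bar>t\<bar> ^ n" and t: "\<bar>t\<bar> \<le> T"
  shows "norm (F t) \<le> C * \<bar>t\<bar> ^ Suc n / Suc n"
proof -
  have pos: "norm (F t) \<le> C * t ^ Suc n / Suc n"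
    if F: "F 0 = 0" "\<And>t. (F has_vector_derivative f t) (at t)"
      and b: "\<And>t. \<bar>t\<bar> \<le> T \<Longrightarrow> norm (f t) \<le> C * \<bar>t\<bar> ^ n" and t: "0 < t" "t \<le> T"
    for F f and t :: real
  proof -
    have "norm (F t - F 0) \<le> C * t ^ Suc n / Suc n - C * 0 ^ Suc n / Suc n"
    proof (rule differentiable_bound_general[where f' = f and \<phi>' = "\<lambda>t. C * t ^ n"])
      show "continuous_on {0..t} F"
        by (meson F(2) continuous_at_imp_continuous_on has_vector_derivative_continuous)
      show "continuous_on {0..t} (\<lambda>t. C * t ^ Suc n / Suc n)"
        by (intro continuous_intros) auto
      show "((\<lambda>t. C * t ^ Suc n / Suc n) has_vector_derivative C * x ^ n) (at x)" for x
        unfolding has_real_derivative_iff_has_vector_derivative[symmetric]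
        by (auto intro!: derivative_eq_intros simp: field_simps simp del: of_nat_Suc power_Suc)
      show "norm (f u) \<le> C * u ^ n" if "0 < u" "u < t" for u
        using b[of u] that t by auto
    qed (use F t in auto)
    then show ?thesis using F by simp
  qed
  consider "t = 0" | "t > 0" | "t < 0" by linarith
  then show ?thesis
  proof cases
    case 1 then show ?thesis using F by simp
  next
    case 2 then show ?thesis using pos[OF F b] t by simp
  next
    case 3
    have "norm ((\<lambda>t. F (-t)) (-t)) \<le> C * (-t) ^ Suc n / Suc n"
    proof (rule pos[of _ "\<lambda>t. - f (-t)"])
      show "((\<lambda>t. F (- t)) has_vector_derivative - f (- t)) (at t)" for t
        using F(2) by (rule has_vector_derivative_reflect)
      show "norm (- f (- s)) \<le> C * \<bar>s\<bar> ^ n" if "\<bar>s\<bar> \<le> T" for s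
        using b[of "- s"] that by simp
    qed (use F 3 t in auto)
    then show ?thesis using 3 by simp
  qed
qed

text \<open>The M-test gives uniform convergence of the derivatives on a ball around 0 containing t;
  convergence at the single point 0 then carries over to the whole ball.\<close>

lemma has_vector_derivative_suminf:
  fixes f :: "nat \<Rightarrow> real \<Rightarrow> complex"
  assumes der: "\<And>n t. (f n has_vector_derivative f' n t) (at t)"
    and bnd: "\<And>T. \<exists>B. summable B \<and> (\<forall>n t. \<bar>t\<bar> \<le> T \<longrightarrow> norm (f' n t) \<le> B n)"
    and s0: "summable (\<lambda>n. f n 0)"
  shows "((\<lambda>t. \<Sum>n. f n t) has_vector_derivative (\<Sum>n. f' n t)) (at t)"
    and "summable (\<lambda>n. f n t)"
proof -
  define S where "S = ball (0::real) (\<bar>t\<bar> + 1)"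
  obtain B where B: "summable B" "\<And>n u. \<bar>u\<bar> \<le> \<bar>t\<bar> + 1 \<Longrightarrow> norm (f' n u) \<le> B n"
    using bnd[of "\<bar>t\<bar> + 1"] by blast
  have ul: "uniform_limit S (\<lambda>n u. \<Sum>i<n. f' i u) (\<lambda>u. \<Sum>i. f' i u) sequentially"
    using B by (intro Weierstrass_m_test) (auto simp: S_def)
  have "\<exists>g. \<forall>x\<in>S. (\<lambda>n. f n x) sums (g x) \<and>
      (g has_derivative (\<lambda>h. h *\<^sub>R (\<Sum>i. f' i x))) (at x within S)"
  proof (rule has_derivative_series[where f' = "\<lambda>n x h. h *\<^sub>R f' n x" and x = 0])
    show "(f n has_derivative (\<lambda>h. h *\<^sub>R f' n x)) (at x within S)" for n x
      using der[of n x] by (simp add: has_vector_derivative_def has_derivative_at_withinI)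
    fix e :: real assume "e > 0"
    from uniform_limitD[OF ul this]
    show "\<forall>\<^sub>F n in sequentially. \<forall>x\<in>S. \<forall>h. norm ((\<Sum>i<n. h *\<^sub>R f' i x) - h *\<^sub>R (\<Sum>i. f' i x)) \<le> e * norm h"
    proof eventually_elim
      case (elim n)
      show ?case
      proof (intro ballI allI)
        fix x h assume "x \<in> S"
        have "norm ((\<Sum>i<n. h *\<^sub>R f' i x) - h *\<^sub>R (\<Sum>i. f' i x)) = \<bar>h\<bar> * dist (\<Sum>i<n. f' i x) (\<Sum>i. f' i x)"
          by (simp add: scaleR_sum_right[symmetric] scaleR_diff_right[symmetric] dist_norm)
        also have "\<dots> \<le> \<bar>h\<bar> * e"
          using elim \<open>x \<in> S\<close> by (intro mult_left_mono) (auto intro: less_imp_le)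
        finally show "norm ((\<Sum>i<n. h *\<^sub>R f' i x) - h *\<^sub>R (\<Sum>i. f' i x)) \<le> e * norm h"
          by (simp add: mult.commute)
      qed
    qed
  qed (use s0 in \<open>auto simp: S_def summable_sums\<close>)
  then obtain g where g: "\<And>x. x \<in> S \<Longrightarrow> (\<lambda>n. f n x) sums (g x)"
    "\<And>x. x \<in> S \<Longrightarrow> (g has_derivative (\<lambda>h. h *\<^sub>R (\<Sum>i. f' i x))) (at x within S)"
    by blast
  have tS: "t \<in> S" "open S" by (auto simp: S_def)
  show "summable (\<lambda>n. f n t)" using g(1)[OF tS(1)] by (simp add: sums_iff)
  have "(g has_vector_derivative (\<Sum>n. f' n t)) (at t)"
    using g(2)[OF tS(1)] at_within_open[OF tS] by (simp add: has_vector_derivative_def)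
  then show "((\<lambda>t. \<Sum>n. f n t) has_vector_derivative (\<Sum>n. f' n t)) (at t)"
    by (rule has_vector_derivative_transform_within_open[OF _ tS(2,1)])
       (use g(1) in \<open>simp add: sums_iff\<close>)
qed

text \<open>Terms of the Picard series, not its partial sums, for the system f' = g, g' = q f: each
  pair integrates the right-hand side of the system at the preceding pair.\<close>

fun picard :: "(real \<Rightarrow> complex) \<Rightarrow> complex \<Rightarrow> complex \<Rightarrow> nat \<Rightarrow> (real \<Rightarrow> complex) \<times> (real \<Rightarrow> complex)"
  where
  "picard q a b 0 = ((\<lambda>_. a), (\<lambda>_. b))"
| "picard q a b (Suc n) =
    (antider (snd (picard q a b n)), antider (\<lambda>t. q t * fst (picard q a b n) t))"

lemma continuous_on_picard:
  assumes "continuous_on UNIV q"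
  shows "continuous_on UNIV (fst (picard q a b n)) \<and> continuous_on UNIV (snd (picard q a b n))"
proof (induction n)
  case (Suc n)
  have "continuous_on UNIV (antider h)" if "continuous_on UNIV h" for h
    using antider(2)[OF that]
    by (meson continuous_at_imp_continuous_on has_vector_derivative_continuous)
  then show ?case using Suc assms by (auto intro!: continuous_on_mult)
qed auto

text \<open>The bounds A K^n |t|^n / n! are summable on every bounded interval, so the series solves
  the equation on the whole line at once, without continuation of local solutions.\<close>

lemma linear_ode_exists:
  fixes q :: "real \<Rightarrow> complex"
  assumes q: "continuous_on UNIV q"
  shows "\<exists>f g. f 0 = a \<and> g 0 = b \<and> (\<forall>t. (f has_vector_derivative g t) (at t)) \<and>
           (\<forall>t. (g has_vector_derivative q t * f t) (at t))"
proof -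
  define u where "u n = fst (picard q a b n)" for n
  define v where "v n = snd (picard q a b n)" for n
  have cont: "continuous_on UNIV (u n)" "continuous_on UNIV (v n)" for n
    using continuous_on_picard[OF q] by (auto simp: u_def v_def)
  have contq: "continuous_on UNIV (\<lambda>t. q t * u n t)" for n
    using cont q by (intro continuous_intros) auto
  have uS: "u (Suc n) = antider (v n)" and vS: "v (Suc n) = antider (\<lambda>t. q t * u n t)" for n
    by (auto simp: u_def v_def)
  have u0: "u 0 = (\<lambda>_. a)" and v0: "v 0 = (\<lambda>_. b)" by (auto simp: u_def v_def)
  have der: "(u (Suc n) has_vector_derivative v n t) (at t)"
    "(v (Suc n) has_vector_derivative q t * u n t) (at t)" for n t
    using antider(2)[OF cont(2), of n t] antider(2)[OF contq, of n t] by (auto simp: uS vS)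
  have init: "u (Suc n) 0 = 0" "v (Suc n) 0 = 0" for n
    using antider(1)[OF cont(2)] antider(1)[OF contq] by (auto simp: uS vS)
  have bnd: "\<exists>B. summable B \<and> (\<forall>n t. \<bar>t\<bar> \<le> T \<longrightarrow> norm (u n t) \<le> B n \<and> norm (v n t) \<le> B n
      \<and> norm (q t * u n t) \<le> B n)" for T
  proof -
    have "compact (q ` {-T..T})"
      by (intro compact_continuous_image continuous_on_subset[OF q]) auto
    then obtain K0 where K0: "\<And>t. t \<in> {-T..T} \<Longrightarrow> norm (q t) \<le> K0"
      by (meson bounded_iff compact_imp_bounded image_eqI)
    \<comment> \<open>K is at least 1 so that one bound serves both components: the first is
      integrated without the factor q, the second with it.\<close>
    define K where "K = max 1 K0"
    have K: "K \<ge> 1" "\<bar>t\<bar> \<le> T \<Longrightarrow> norm (q t) \<le> K" for t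
      using K0[of t] by (auto simp: K_def abs_le_iff)
    define A where "A = norm a + norm b"
    have A: "A \<ge> 0" by (simp add: A_def)
    have ind: "\<bar>t\<bar> \<le> T \<Longrightarrow> norm (u n t) \<le> A * K ^ n / fact n * \<bar>t\<bar> ^ n \<and>
        norm (v n t) \<le> A * K ^ n / fact n * \<bar>t\<bar> ^ n" for n t
    proof (induction n arbitrary: t)
      case 0
      then show ?case by (auto simp: u0 v0 A_def)
    next
      case (Suc n)
      define C where "C = A * K ^ n / fact n * K"
      have C0: "A * K ^ n / fact n \<ge> 0" using A K by auto
      have le: "A * K ^ n / fact n * \<bar>s\<bar> ^ n \<le> C * \<bar>s\<bar> ^ n" for s
        using C0 K mult_left_mono[OF K(1) C0] unfolding C_def
        by (intro mult_right_mono) auto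
      have "norm (u (Suc n) t) \<le> C * \<bar>t\<bar> ^ Suc n / Suc n"
        using Suc.prems
        by (intro antiderivative_power_bound[OF init(1) der(1)])
           (use Suc.IH le in \<open>auto intro: order_trans\<close>)
      moreover have "norm (v (Suc n) t) \<le> C * \<bar>t\<bar> ^ Suc n / Suc n"
      proof (rule antiderivative_power_bound[OF init(2) der(2) _ Suc.prems])
        fix s assume s: "\<bar>s\<bar> \<le> T"
        have "norm (q s * u n s) \<le> K * (A * K ^ n / fact n * \<bar>s\<bar> ^ n)"
          unfolding norm_mult using Suc.IH[OF s] K s by (intro mult_mono) auto
        then show "norm (q s * u n s) \<le> C * \<bar>s\<bar> ^ n" by (simp add: C_def mult_ac)
      qed
      moreover have "C * \<bar>t\<bar> ^ Suc n / Suc n = A * K ^ Suc n / fact (Suc n) * \<bar>t\<bar> ^ Suc n"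
        by (simp add: C_def field_simps)
      ultimately show ?case by simp
    qed
    define B where "B n = K * (A * (inverse (fact n) * (K * \<bar>T\<bar>) ^ n))" for n
    have "summable B" unfolding B_def by (intro summable_mult summable_exp)
    moreover have "norm (u n t) \<le> B n \<and> norm (v n t) \<le> B n \<and> norm (q t * u n t) \<le> B n"
      if t: "\<bar>t\<bar> \<le> T" for n t
    proof -
      have "A * K ^ n / fact n * \<bar>t\<bar> ^ n \<le> A * K ^ n / fact n * \<bar>T\<bar> ^ n"
        using A K t by (intro mult_left_mono power_mono) auto
      also have "\<dots> = A * (inverse (fact n) * (K * \<bar>T\<bar>) ^ n)"
        by (simp add: field_simps power_mult_distrib)
      finally have *: "A * K ^ n / fact n * \<bar>t\<bar> ^ n \<le> A * (inverse (fact n) * (K * \<bar>T\<bar>) ^ n)" .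
      have "A * (inverse (fact n) * (K * \<bar>T\<bar>) ^ n) \<ge> 0" using A K by auto
      then have **: "A * (inverse (fact n) * (K * \<bar>T\<bar>) ^ n) \<le> B n"
        unfolding B_def using K(1) mult_right_mono[OF K(1)] by fastforce
      have "norm (q t * u n t) \<le> B n" unfolding norm_mult B_def
        using ind[OF t, of n] * K t by (intro mult_mono) auto
      then show ?thesis using ind[OF t, of n] * ** by auto
    qed
    ultimately show ?thesis by blast
  qed
  \<comment> \<open>Index shift: the derivative of term n is built from term n - 1, and the initial
    terms are constants, whence 0 at index 0.\<close>
  define u' where "u' n = (if n = 0 then (\<lambda>_. 0) else v (n - 1))" for n
  define v' where "v' n = (if n = 0 then (\<lambda>_. 0) else (\<lambda>t. q t * u (n - 1) t))" for n
  have du: "(u n has_vector_derivative u' n t) (at t)" and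
    dv: "(v n has_vector_derivative v' n t) (at t)" for n t
    using der by (cases n; auto simp: u'_def v'_def u0 v0)+
  have sum0: "summable (\<lambda>n. u n 0)" "summable (\<lambda>n. v n 0)"
    by (rule summable_finite[of "{0}"]; use init in \<open>auto simp: neq0_conv dest!: gr0_implies_Suc\<close>)+
  have bnd': "\<exists>B. summable B \<and> (\<forall>n t. \<bar>t\<bar> \<le> T \<longrightarrow> norm (u' n t) \<le> B n)"
     "\<exists>B. summable B \<and> (\<forall>n t. \<bar>t\<bar> \<le> T \<longrightarrow> norm (v' n t) \<le> B n)" for T
  proof -
    obtain B where B: "summable B" "\<And>n t. \<bar>t\<bar> \<le> T \<Longrightarrow> norm (u n t) \<le> B n \<and> norm (v n t) \<le> B n
      \<and> norm (q t * u n t) \<le> B n"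
      using bnd[of T] by blast
    define B' where "B' n = (if n = 0 then 0 else B (n - 1))" for n
    have "summable (\<lambda>n. B' (Suc n))" using B by (simp add: B'_def)
    then have "summable B'" by (simp only: summable_Suc_iff)
    moreover have "norm (u' n t) \<le> B' n" "norm (v' n t) \<le> B' n" if "\<bar>t\<bar> \<le> T" for n t
      using B(2)[OF that] by (auto simp: u'_def v'_def B'_def)
    ultimately show "\<exists>B. summable B \<and> (\<forall>n t. \<bar>t\<bar> \<le> T \<longrightarrow> norm (u' n t) \<le> B n)"
     "\<exists>B. summable B \<and> (\<forall>n t. \<bar>t\<bar> \<le> T \<longrightarrow> norm (v' n t) \<le> B n)" by blast+
  qed
  define f where "f t = (\<Sum>n. u n t)" for t
  define g where "g t = (\<Sum>n. v n t)" for t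
  note U = has_vector_derivative_suminf[OF du bnd'(1) sum0(1)]
  note V = has_vector_derivative_suminf[OF dv bnd'(2) sum0(2)]
  have "summable (\<lambda>n. u' n t)" for t
    using V(2)[of t] by (subst summable_Suc_iff[symmetric]) (simp add: u'_def)
  then have "(\<Sum>n. u' n t) = g t" for t
    using suminf_split_head[of "\<lambda>n. u' n t"] by (simp add: u'_def g_def)
  then have "(f has_vector_derivative g t) (at t)" for t
    using U(1)[of t] by (simp add: f_def[abs_def])
  moreover have "summable (\<lambda>n. v' n t)" for t
    using U(2)[of t] by (subst summable_Suc_iff[symmetric]) (simp add: v'_def summable_mult)
  then have "(\<Sum>n. v' n t) = q t * f t" for t
    using suminf_split_head[of "\<lambda>n. v' n t"] U(2)[of t] by (simp add: v'_def f_def suminf_mult)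
  then have "(g has_vector_derivative q t * f t) (at t)" for t
    using V(1)[of t] by (simp add: g_def[abs_def])
  moreover have "f 0 = a"
    using suminf_split_head[OF sum0(1)] init by (simp add: f_def u0)
  moreover have "g 0 = b"
    using suminf_split_head[OF sum0(2)] init by (simp add: g_def v0)
  ultimately show ?thesis by blast
qed

text \<open>Gronwall's argument: the derivative of |f|^2 + |g|^2 is at most 1 + Q times that energy,
  so its product with exp(-(1 + Q) t) does not increase. This serves uniqueness as well as bounds
  locally uniform in the spectral parameter.\<close>

lemma linear_ode_energy_bound:
  fixes f g q :: "real \<Rightarrow> complex"
  assumes f: "\<And>t. 0 \<le> t \<Longrightarrow> t \<le> T \<Longrightarrow> (f has_vector_derivative g t) (at t)"
    and g: "\<And>t. 0 \<le> t \<Longrightarrow> t \<le> T \<Longrightarrow> (g has_vector_derivative q t * f t) (at t)"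
    and q: "\<And>t. 0 \<le> t \<Longrightarrow> t \<le> T \<Longrightarrow> norm (q t) \<le> Q" and t: "0 \<le> t" "t \<le> T"
  shows "(norm (f t))\<^sup>2 + (norm (g t))\<^sup>2 \<le> exp ((1 + Q) * t) * ((norm (f 0))\<^sup>2 + (norm (g 0))\<^sup>2)"
proof -
  define E where "E t = f t \<bullet> f t + g t \<bullet> g t" for t
  have "exp (- (1 + Q) * t) * E t \<le> exp (- (1 + Q) * 0) * E 0"
  proof (rule DERIV_nonpos_imp_nonincreasing[OF t(1)])
    fix s assume s: "0 \<le> s" "s \<le> t"
    define D where "D = exp (- (1 + Q) * s) * (2 * (f s \<bullet> g s) + 2 * (g s \<bullet> (q s * f s)) - (1 + Q) * E s)"
    have fd: "(f has_derivative (\<lambda>h. h *\<^sub>R g s)) (at s)" and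
      gd: "(g has_derivative (\<lambda>h. h *\<^sub>R (q s * f s))) (at s)"
      using f[of s] g[of s] s t by (auto simp: has_vector_derivative_def)
    have "((\<lambda>t. exp (- (1 + Q) * t) * E t) has_real_derivative D) (at s)"
      unfolding E_def has_field_derivative_def
      by (rule derivative_eq_intros fd gd refl)+
         (auto simp: D_def E_def fun_eq_iff algebra_simps inner_commute)
    moreover have "D \<le> 0"
    proof -
      have 1: "2 * (norm (f s) * norm (g s)) \<le> E s"
        using sum_squares_bound[of "norm (f s)" "norm (g s)"]
        by (simp add: E_def power2_norm_eq_inner)
      have 2: "f s \<bullet> g s \<le> norm (f s) * norm (g s)" by (rule norm_cauchy_schwarz)
      have Q0: "Q \<ge> 0" using q[of s] s t norm_ge_zero[of "q s"] by linarith
      have "g s \<bullet> (q s * f s) \<le> norm (g s) * norm (q s * f s)" by (rule norm_cauchy_schwarz)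
      also have "\<dots> \<le> Q * (norm (f s) * norm (g s))"
        using mult_right_mono[OF q[of s], of "norm (f s) * norm (g s)"] s t
        by (simp add: norm_mult mult_ac)
      finally have 3: "2 * (g s \<bullet> (q s * f s)) \<le> Q * E s"
        using mult_left_mono[OF 1 Q0] by linarith
      have "2 * (f s \<bullet> g s) + 2 * (g s \<bullet> (q s * f s)) - (1 + Q) * E s \<le> 0"
        using 1 2 3 by (simp add: algebra_simps)
      then show ?thesis unfolding D_def by (simp add: mult_le_0_iff)
    qed
    ultimately show "\<exists>y. ((\<lambda>t. exp (- (1 + Q) * t) * E t) has_real_derivative y) (at s) \<and> y \<le> 0"
      by blast
  qed
  then have "exp ((1 + Q) * t) * (exp (- (1 + Q) * t) * E t) \<le> exp ((1 + Q) * t) * E 0"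
    by (intro mult_left_mono) auto
  then show ?thesis
    by (simp add: E_def power2_norm_eq_inner mult.assoc[symmetric] mult_exp_exp flip: distrib_right)
qed

lemma linear_ode_unique:
  fixes f g q :: "real \<Rightarrow> complex"
  assumes q: "continuous_on UNIV q"
    and f: "\<And>t. (f has_vector_derivative g t) (at t)"
    and g: "\<And>t. (g has_vector_derivative q t * f t) (at t)"
    and 0: "f 0 = 0" "g 0 = 0"
  shows "f t = 0 \<and> g t = 0"
proof -
  have bd: "\<exists>K. \<forall>t\<in>{-T..T}. norm (q t) \<le> K" for T
  proof -
    have "compact (q ` {-T..T})"
      by (intro compact_continuous_image continuous_on_subset[OF q]) auto
    then show ?thesis by (auto simp: bounded_iff dest!: compact_imp_bounded)
  qed
  obtain K where K: "\<And>s. s \<in> {-\<bar>t\<bar>..\<bar>t\<bar>} \<Longrightarrow> norm (q s) \<le> K"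
    using bd by meson
  show ?thesis
  proof (cases "t \<ge> 0")
    case True
    then show ?thesis
      using linear_ode_energy_bound[of t f g q K t] f g K 0 by (simp add: add_nonneg_eq_0_iff sum_power2_le_zero_iff)
  next
    case False
    \<comment> \<open>Reversing time preserves the shape of the system once the sign of g is
      changed, so the energy bound reaches negative t.\<close>
    have "((\<lambda>t. f (- t)) has_vector_derivative - g (- s)) (at s)"
      "((\<lambda>t. - g (- t)) has_vector_derivative q (- s) * f (- s)) (at s)" for s
      using has_vector_derivative_reflect[OF f]
        has_vector_derivative_minus[OF has_vector_derivative_reflect[OF g]] by simp_all
    then have "(norm (f (- (-t))))\<^sup>2 + (norm (- g (- (-t))))\<^sup>2 \<le>
        exp ((1 + K) * (-t)) * ((norm (f (- 0)))\<^sup>2 + (norm (- g (- 0)))\<^sup>2)"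
      using False K
      by (intro linear_ode_energy_bound[of "-t" "\<lambda>t. f (-t)" "\<lambda>t. - g (-t)" "\<lambda>t. q (-t)" K "-t"]) auto
    then show ?thesis using 0 by (simp add: sum_power2_le_zero_iff)
  qed
qed

subsection \<open>Solutions and their dependence on the spectral parameter\<close>

lemma is_solD:
  assumes "is_sol V lam f"
  shows "(f has_vector_derivative vector_derivative f (at t)) (at t)"
    and "((\<lambda>u. vector_derivative f (at u)) has_vector_derivative (V t - lam) * f t) (at t)"
  using assms by (auto simp: is_sol_def vector_derivative_works)

lemma is_solI:
  assumes f: "\<And>t. (f has_vector_derivative g t) (at t)"
    and g: "\<And>t. (g has_vector_derivative (V t - lam) * f t) (at t)"
  shows "is_sol V lam f" "(\<lambda>t. vector_derivative f (at t)) = g"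
proof -
  show eq: "(\<lambda>t. vector_derivative f (at t)) = g"
    using f by (auto intro: vector_derivative_at)
  show "is_sol V lam f"
    unfolding is_sol_def eq using f g by (auto intro: differentiableI_vector)
qed

lemma has_vector_derivative_shift:
  assumes "(f has_vector_derivative d) (at (t + x))"
  shows "((\<lambda>t. f (t + x)) has_vector_derivative d) (at (t::real))"
proof -
  have "((\<lambda>t. t + x) has_vector_derivative 1) (at t)"
    by (auto intro!: derivative_eq_intros)
  from vector_diff_chain_at[OF this assms] show ?thesis by (simp add: o_def)
qed

text \<open>This gives meaning to the \<open>THE\<close> in \<open>csol\<close> and
  \<open>ssol\<close>. The initial point is moved to 0, where existence and uniqueness are already
  available.\<close>

lemma is_sol_ex1:
  assumes V: "continuous_on UNIV V"
  shows "\<exists>!f. is_sol V lam f \<and> f x0 = a \<and> vector_derivative f (at x0) = b"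
proof -
  define q where "q t = V (t + x0) - lam" for t
  have q: "continuous_on UNIV q" unfolding q_def
    by (intro continuous_intros continuous_on_compose2[OF V]) auto
  obtain f g where fg: "f 0 = a" "g 0 = b" "\<And>t. (f has_vector_derivative g t) (at t)"
    "\<And>t. (g has_vector_derivative q t * f t) (at t)"
    using linear_ode_exists[OF q] by meson
  have "((\<lambda>t. f (t + - x0)) has_vector_derivative g (t + - x0)) (at t)"
    "((\<lambda>t. g (t + - x0)) has_vector_derivative (V t - lam) * f (t + - x0)) (at t)" for t
    using has_vector_derivative_shift[of f _ t "-x0", OF fg(3)]
      has_vector_derivative_shift[of g _ t "-x0", OF fg(4)] by (simp_all add: q_def)
  note * = is_solI[OF this]
  have ex: "is_sol V lam (\<lambda>t. f (t + - x0)) \<and> f (x0 + - x0) = a \<and>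
    vector_derivative (\<lambda>t. f (t + - x0)) (at x0) = b"
    using *(1) fun_cong[OF *(2), of x0] fg by simp
  have uniq: "f1 = f2" if 1: "is_sol V lam f1 \<and> f1 x0 = a \<and> vector_derivative f1 (at x0) = b"
    and 2: "is_sol V lam f2 \<and> f2 x0 = a \<and> vector_derivative f2 (at x0) = b" for f1 f2
  proof
    fix t
    define h where "h t = f1 (t + x0) - f2 (t + x0)" for t
    define h' where "h' t = vector_derivative f1 (at (t + x0)) - vector_derivative f2 (at (t + x0))" for t
    have "h (t - x0) = 0 \<and> h' (t - x0) = 0"
    proof (rule linear_ode_unique[OF q])
      show "(h has_vector_derivative h' s) (at s)" for s
        unfolding h_def h'_def
        using 1 2 by (intro has_vector_derivative_diff has_vector_derivative_shift is_solD(1)) auto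
      have "(h' has_vector_derivative (V (s + x0) - lam) * f1 (s + x0) - (V (s + x0) - lam) * f2 (s + x0)) (at s)" for s
        unfolding h'_def using 1 2
        by (intro has_vector_derivative_diff has_vector_derivative_shift[where f = "\<lambda>u. vector_derivative _ (at u)"] is_solD(2)) auto
      then show "(h' has_vector_derivative q s * h s) (at s)" for s
        by (simp add: q_def h_def right_diff_distrib)
    qed (use 1 2 in \<open>auto simp: h_def h'_def\<close>)
    then show "f1 t = f2 t" by (simp add: h_def)
  qed
  show ?thesis
    unfolding Ex1_def using uniq ex by blast
qed

lemma is_sol_unique:
  assumes "continuous_on UNIV V" "is_sol V lam f" "is_sol V lam g"
    and "f x = g x" "vector_derivative f (at x) = vector_derivative g (at x)"
  shows "f = g"
proof -
  let ?P = "\<lambda>h. is_sol V lam h \<and> h x = f x \<and> vector_derivative h (at x) = vector_derivative f (at x)"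
  have "?P f" "?P g" using assms by simp_all
  moreover have ex1: "\<exists>!h. ?P h" by (rule is_sol_ex1[OF assms(1)])
  ultimately have "(THE h. ?P h) = f" "(THE h. ?P h) = g" by (auto intro!: the1_equality)
  then show ?thesis by simp
qed

lemma csol:
  assumes "continuous_on UNIV V"
  shows "is_sol V lam (csol V lam x0)" "csol V lam x0 x0 = 1" "vector_derivative (csol V lam x0) (at x0) = 0"
  using theI'[OF is_sol_ex1[OF assms, of lam x0 1 0]] unfolding csol_def by auto

lemma ssol:
  assumes "continuous_on UNIV V"
  shows "is_sol V lam (ssol V lam x0)" "ssol V lam x0 x0 = 0" "vector_derivative (ssol V lam x0) (at x0) = 1"
  using theI'[OF is_sol_ex1[OF assms, of lam x0 0 1]] unfolding ssol_def by auto

lemma is_sol_combination: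
  assumes V: "continuous_on UNIV V" and f: "is_sol V lam f"
  shows "f t = f x * csol V lam x t + vector_derivative f (at x) * ssol V lam x t"
    and "vector_derivative f (at t) = f x * vector_derivative (csol V lam x) (at t)
           + vector_derivative f (at x) * vector_derivative (ssol V lam x) (at t)"
proof -
  define a where "a = f x"
  define b where "b = vector_derivative f (at x)"
  define g where "g t = a * csol V lam x t + b * ssol V lam x t" for t
  define g' where "g' t = a * vector_derivative (csol V lam x) (at t) + b * vector_derivative (ssol V lam x) (at t)" for t
  note c = csol[OF V, of lam x] and s = ssol[OF V, of lam x]
  have 1: "(g has_vector_derivative g' t) (at t)" for t
    unfolding g_def g'_def using is_solD(1)[OF c(1)] is_solD(1)[OF s(1)]
    by (intro has_vector_derivative_add has_vector_derivative_mult_right) auto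
  have "(g' has_vector_derivative a * ((V t - lam) * csol V lam x t) + b * ((V t - lam) * ssol V lam x t)) (at t)" for t
    unfolding g'_def using is_solD(2)[OF c(1)] is_solD(2)[OF s(1)]
    by (intro has_vector_derivative_add has_vector_derivative_mult_right) auto
  then have 2: "(g' has_vector_derivative (V t - lam) * g t) (at t)" for t
    by (simp add: g_def algebra_simps)
  note * = is_solI[OF 1 2]
  have "g x = a" by (simp add: g_def c s)
  moreover have "vector_derivative g (at x) = b"
    using fun_cong[OF *(2), of x] by (simp add: g'_def c s)
  ultimately have "f = g"
    by (intro is_sol_unique[OF V f *(1), of x]) (simp_all add: a_def b_def)
  then have "f t = g t" "vector_derivative f (at t) = g' t"
    using fun_cong[OF *(2), of t] by (simp_all only:)
  then show "f t = f x * csol V lam x t + vector_derivative f (at x) * ssol V lam x t"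
    and "vector_derivative f (at t) = f x * vector_derivative (csol V lam x) (at t)
           + vector_derivative f (at x) * vector_derivative (ssol V lam x) (at t)"
    by (simp_all only: g_def g'_def a_def b_def)
qed

lemma is_sol_shift:
  assumes "is_sol V lam f" and per: "\<forall>t. V (t + p) = V t"
  shows "is_sol V lam (\<lambda>t. f (t + p))"
    and "vector_derivative (\<lambda>t. f (t + p)) (at t) = vector_derivative f (at (t + p))"
proof -
  have 1: "((\<lambda>t. f (t + p)) has_vector_derivative vector_derivative f (at (t + p))) (at t)" for t
    using has_vector_derivative_shift[where f = f and t = t and x = p] is_solD(1)[OF assms(1)] by blast
  have 2: "((\<lambda>t. vector_derivative f (at (t + p))) has_vector_derivative (V t - lam) * f (t + p)) (at t)" for t
    using has_vector_derivative_shift[where f = "\<lambda>u. vector_derivative f (at u)" and x = p and t = t]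
      is_solD(2)[OF assms(1), of "t + p"] per by simp
  show "is_sol V lam (\<lambda>t. f (t + p))"
    and "vector_derivative (\<lambda>t. f (t + p)) (at t) = vector_derivative f (at (t + p))"
    using is_solI(1)[OF 1 2] fun_cong[OF is_solI(2)[OF 1 2], of t] by auto
qed

lemma wronskian:
  fixes c s :: "real \<Rightarrow> complex"
  assumes "\<And>t. (c has_vector_derivative c1 t) (at t)" "\<And>t. (c1 has_vector_derivative q t * c t) (at t)"
    and "\<And>t. (s has_vector_derivative s1 t) (at t)" "\<And>t. (s1 has_vector_derivative q t * s t) (at t)"
  shows "c t * s1 t - c1 t * s t = c u * s1 u - c1 u * s u"
proof -
  have "((\<lambda>t. c t * s1 t - c1 t * s t) has_vector_derivative
      (c t * (q t * s t) + c1 t * s1 t) - (c1 t * s1 t + q t * c t * s t)) (at t)" for t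
    by (intro has_vector_derivative_diff has_vector_derivative_mult assms)
  then have "((\<lambda>t. c t * s1 t - c1 t * s t) has_vector_derivative 0) (at t)" for t
    by (simp add: algebra_simps)
  then obtain k where "\<And>t. c t * s1 t - c1 t * s t = k"
    using has_vector_derivative_zero_constant[of UNIV "\<lambda>t. c t * s1 t - c1 t * s t"] by auto
  then show ?thesis by simp
qed

text \<open>The discriminant is half the trace of the monodromy map; passing from the base point 0 to the
  base point x conjugates that map by a matrix of determinant 1.\<close>
lemma discr_base_point:
  assumes V: "continuous_on UNIV V" and per: "\<forall>t. V (t + pi) = V t"
  shows "discr V lam = (csol V lam x (x + pi) + vector_derivative (ssol V lam x) (at (x + pi))) / 2"
proof -
  let ?cz = "csol V lam 0" and ?sz = "ssol V lam 0" and ?c = "csol V lam x" and ?s = "ssol V lam x"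
  note c0 = csol[OF V, of lam 0] and s0 = ssol[OF V, of lam 0] and c = csol[OF V, of lam x] and s = ssol[OF V, of lam x]
  note comb = is_sol_combination[OF V, of lam _ _ x]
  define A C B D where "A = ?c (x + pi)" and "C = vector_derivative ?c (at (x + pi))"
    and "B = ?s (x + pi)" and "D = vector_derivative ?s (at (x + pi))"
  define p q r v where "p = ?cz x" and "q = vector_derivative ?cz (at x)"
    and "r = ?sz x" and "v = vector_derivative ?sz (at x)"
  define c' s' where "c' = vector_derivative ?c (at 0)" and "s' = vector_derivative ?s (at 0)"
  \<comment> \<open>By constancy of the Wronskian, the transition matrix between the two base points
    has determinant 1.\<close>
  have w: "p * v - q * r = 1"
    using wronskian[OF is_solD[OF c0(1)] is_solD[OF s0(1)], of x 0] c0 s0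
    by (simp add: p_def q_def r_def v_def)
  have 1: "p * ?c 0 + q * ?s 0 = 1" "r * ?c 0 + v * ?s 0 = 0"
    "p * c' + q * s' = 0" "r * c' + v * s' = 1"
    using comb(1)[OF c0(1), of 0] comb(1)[OF s0(1), of 0] comb(2)[OF c0(1), of 0] comb(2)[OF s0(1), of 0] c0 s0
    by (simp_all add: p_def q_def r_def v_def c'_def s'_def)
  have 2: "?c pi = A * ?c 0 + C * ?s 0" "?s pi = B * ?c 0 + D * ?s 0"
    using is_sol_combination(1)[OF V is_sol_shift(1)[OF c(1) per], of 0 x]
      is_sol_combination(1)[OF V is_sol_shift(1)[OF s(1) per], of 0 x]
      is_sol_shift(2)[OF c(1) per] is_sol_shift(2)[OF s(1) per]
    by (simp_all add: A_def B_def C_def D_def)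
  have 3: "vector_derivative ?c (at pi) = A * c' + C * s'" "vector_derivative ?s (at pi) = B * c' + D * s'"
    using is_sol_combination(2)[OF V is_sol_shift(1)[OF c(1) per], of 0 x]
      is_sol_combination(2)[OF V is_sol_shift(1)[OF s(1) per], of 0 x]
      is_sol_shift(2)[OF c(1) per] is_sol_shift(2)[OF s(1) per]
    by (simp_all add: A_def B_def C_def D_def c'_def s'_def)
  \<comment> \<open>The values at 0 of the system based at x form the inverse of the transition
    matrix, hence its adjugate. Each unknown is written as a combination of the equations plus a
    multiple of 1 - det, which vanishes.\<close>
  have 4: "?c 0 = v" "?s 0 = - r" "c' = - q" "s' = p"
  proof -
    have "?c 0 = v * (p * ?c 0 + q * ?s 0) - q * (r * ?c 0 + v * ?s 0) + ?c 0 * (1 - (p * v - q * r))"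
      "?s 0 = p * (r * ?c 0 + v * ?s 0) - r * (p * ?c 0 + q * ?s 0) + ?s 0 * (1 - (p * v - q * r))"
      "c' = v * (p * c' + q * s') - q * (r * c' + v * s') + c' * (1 - (p * v - q * r))"
      "s' = p * (r * c' + v * s') - r * (p * c' + q * s') + s' * (1 - (p * v - q * r))"
      by (simp_all add: algebra_simps)
    then show "?c 0 = v" "?s 0 = - r" "c' = - q" "s' = p"
      unfolding 1 w by simp_all
  qed
  have "?cz pi = p * ?c pi + q * ?s pi"
    using comb(1)[OF c0(1), of pi] by (simp add: p_def q_def)
  moreover have "vector_derivative ?sz (at pi) = r * (A * c' + C * s') + v * (B * c' + D * s')"
    using comb(2)[OF s0(1), of pi] 3 by (simp add: r_def v_def)
  moreover have "p * (A * v + C * (- r)) + q * (B * v + D * (- r)) + (r * (A * (- q) + C * p) + v * (B * (- q) + D * p))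
      = (A + D) * (p * v - q * r)"
    by (simp add: algebra_simps)
  ultimately have "?cz pi + vector_derivative ?sz (at pi) = A + D"
    using w by (simp add: 2 4)
  then show ?thesis by (simp add: discr_def A_def D_def)
qed

section \<open>Holomorphic dependence of solutions on the spectral parameter\<close>

lemma has_integral_vector_derivative:
  fixes f :: "real \<Rightarrow> complex"
  assumes "a \<le> b" "\<And>t. a \<le> t \<Longrightarrow> t \<le> b \<Longrightarrow> (f has_vector_derivative f' t) (at t)"
  shows "(f' has_integral (f b - f a)) {a..b}"
  using assms by (intro fundamental_theorem_of_calculus) (auto intro: has_vector_derivative_at_within)

lemma norm_integral_le:
  fixes g :: "real \<Rightarrow> complex"
  assumes "continuous_on {0..t} g" "0 \<le> t" "\<And>u. 0 \<le> u \<Longrightarrow> u \<le> t \<Longrightarrow> norm (g u) \<le> B"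
  shows "norm (integral {0..t} g) \<le> t * B"
  using integral_bound[of 0 t g B] assms by (auto simp: mult.commute)

text \<open>Solutions for all spectral parameters at once, with the base point translated to 0.
  Keeping them abstract lets the same results serve the given potential and the zero
  potential.\<close>

locale fundamental_system =
  fixes W :: "real \<Rightarrow> complex" and c c1 s s1 :: "complex \<Rightarrow> real \<Rightarrow> complex"
  assumes contW: "continuous_on UNIV W"
    and c: "\<And>l t. (c l has_vector_derivative c1 l t) (at t)"
    and c1: "\<And>l t. (c1 l has_vector_derivative (W t - l) * c l t) (at t)"
    and c0: "\<And>l. c l 0 = 1" "\<And>l. c1 l 0 = 0"
    and s: "\<And>l t. (s l has_vector_derivative s1 l t) (at t)"
    and s1: "\<And>l t. (s1 l has_vector_derivative (W t - l) * s l t) (at t)"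
    and s0: "\<And>l. s l 0 = 0" "\<And>l. s1 l 0 = 1"
begin

lemma wronskian_cs: "c l t * s1 l t - c1 l t * s l t = 1"
  using wronskian[OF c c1 s s1, of l t 0] c0 s0 by simp

lemma cont: "continuous_on A (c l)" "continuous_on A (c1 l)" "continuous_on A (s l)" "continuous_on A (s1 l)"
  by (meson c c1 s s1 continuous_at_imp_continuous_on has_vector_derivative_continuous)+

text \<open>The potential cancels in the derivative of the Wronskian of solutions for two
  parameters, leaving (l - m) f g.\<close>

lemma lagrange_identity:
  assumes f: "\<And>t. (f has_vector_derivative f1 t) (at t)"
      "\<And>t. (f1 has_vector_derivative (W t - l) * f t) (at t)"
    and g: "\<And>t. (g has_vector_derivative g1 t) (at t)"
      "\<And>t. (g1 has_vector_derivative (W t - m) * g t) (at t)" and t: "0 \<le> t"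
  shows "f t * g1 t - f1 t * g t = f 0 * g1 0 - f1 0 * g 0 + (l - m) * integral {0..t} (\<lambda>u. f u * g u)"
proof -
  have "((\<lambda>u. f u * g1 u - f1 u * g u) has_vector_derivative
      (f t * ((W t - m) * g t) + f1 t * g1 t) - (f1 t * g1 t + ((W t - l) * f t) * g t)) (at t)" for t
    by (intro has_vector_derivative_diff has_vector_derivative_mult f g)
  then have "((\<lambda>u. f u * g1 u - f1 u * g u) has_vector_derivative (l - m) * (f t * g t)) (at t)" for t
    by (simp add: algebra_simps)
  from has_integral_vector_derivative[OF t this]
  have "((\<lambda>u. (l - m) * (f u * g u)) has_integral
     (f t * g1 t - f1 t * g t - (f 0 * g1 0 - f1 0 * g 0))) {0..t}" .
  then have "integral {0..t} (\<lambda>u. (l - m) * (f u * g u)) = f t * g1 t - f1 t * g t - (f 0 * g1 0 - f1 0 * g 0)"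
    by (rule integral_unique)
  then show ?thesis by simp
qed

text \<open>Lagrange's identity against \<open>c m\<close> and \<open>s m\<close> gives two linear
  equations for \<open>f l t\<close> and \<open>f1 l t\<close>, with the Wronskian 1 as determinant.
  The factor l - m becomes explicit, so the difference quotient is known exactly.\<close>

lemma spectral_difference:
  fixes f f1 :: "complex \<Rightarrow> real \<Rightarrow> complex"
  assumes f: "\<And>l t. (f l has_vector_derivative f1 l t) (at t)"
      "\<And>l t. (f1 l has_vector_derivative (W t - l) * f l t) (at t)"
    and f0: "\<And>l. f l 0 = a" "\<And>l. f1 l 0 = b" and t: "0 \<le> t"
  shows "f l t - f m t = (c m t * integral {0..t} (\<lambda>u. f l u * s m u) - s m t * integral {0..t} (\<lambda>u. f l u * c m u)) * (l - m)"
    and "f1 l t - f1 m t = (c1 m t * integral {0..t} (\<lambda>u. f l u * s m u) - s1 m t * integral {0..t} (\<lambda>u. f l u * c m u)) * (l - m)"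
proof -
  define I J where "I = integral {0..t} (\<lambda>u. f l u * s m u)" and "J = integral {0..t} (\<lambda>u. f l u * c m u)"
  have 1: "f l t * s1 m t - f1 l t * s m t = a + (l - m) * I"
    using lagrange_identity[OF f s s1 t] by (simp add: f0 s0 I_def)
  have 2: "f l t * c1 m t - f1 l t * c m t = - b + (l - m) * J"
    using lagrange_identity[OF f c c1 t] by (simp add: f0 c0 J_def)
  have 3: "f m t * s1 m t - f1 m t * s m t = a" "f m t * c1 m t - f1 m t * c m t = - b"
    using lagrange_identity[OF f s s1 t, of m m] lagrange_identity[OF f c c1 t, of m m] by (simp_all add: f0 s0 c0)
  show "f l t - f m t = (c m t * integral {0..t} (\<lambda>u. f l u * s m u) - s m t * integral {0..t} (\<lambda>u. f l u * c m u)) * (l - m)"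
    "f1 l t - f1 m t = (c1 m t * integral {0..t} (\<lambda>u. f l u * s m u) - s1 m t * integral {0..t} (\<lambda>u. f l u * c m u)) * (l - m)"
    unfolding I_def[symmetric] J_def[symmetric]
  proof -
    have *: "x = c m t * (x * s1 m t - y * s m t) - s m t * (x * c1 m t - y * c m t)"
      "y = c1 m t * (x * s1 m t - y * s m t) - s1 m t * (x * c1 m t - y * c m t)" for x y
    proof -
      have "c m t * (x * s1 m t - y * s m t) - s m t * (x * c1 m t - y * c m t)
          = x * (c m t * s1 m t - c1 m t * s m t)"
        "c1 m t * (x * s1 m t - y * s m t) - s1 m t * (x * c1 m t - y * c m t)
          = y * (c m t * s1 m t - c1 m t * s m t)"
        by (simp_all add: algebra_simps)
      then show "x = c m t * (x * s1 m t - y * s m t) - s m t * (x * c1 m t - y * c m t)"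
        "y = c1 m t * (x * s1 m t - y * s m t) - s1 m t * (x * c1 m t - y * c m t)"
        by (simp_all add: wronskian_cs)
    qed
    have "f l t = c m t * (a + (l - m) * I) - s m t * (- b + (l - m) * J)"
      "f1 l t = c1 m t * (a + (l - m) * I) - s1 m t * (- b + (l - m) * J)"
      using *(1)[of "f l t" "f1 l t"] *(2)[of "f1 l t" "f l t"] unfolding 1 2 .
    moreover have "f m t = c m t * a - s m t * (- b)" "f1 m t = c1 m t * a - s1 m t * (- b)"
      using *(1)[of "f m t" "f1 m t"] *(2)[of "f1 m t" "f m t"] unfolding 3 .
    ultimately show "f l t - f m t = (c m t * I - s m t * J) * (l - m)"
      "f1 l t - f1 m t = (c1 m t * I - s1 m t * J) * (l - m)"
      by (simp_all add: algebra_simps)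
  qed
qed

lemma sol_locally_bounded:
  fixes f f1 :: "complex \<Rightarrow> real \<Rightarrow> complex"
  assumes f: "\<And>l t. (f l has_vector_derivative f1 l t) (at t)"
      "\<And>l t. (f1 l has_vector_derivative (W t - l) * f l t) (at t)"
    and f0: "\<And>l. f l 0 = a" "\<And>l. f1 l 0 = b"
  shows "\<exists>B\<ge>0. \<forall>l t. norm (l - m) \<le> 1 \<longrightarrow> 0 \<le> t \<longrightarrow> t \<le> T \<longrightarrow> norm (f l t) \<le> B"
proof -
  have "compact (W ` {0..T})"
    by (intro compact_continuous_image continuous_on_subset[OF contW]) auto
  then obtain K where "\<forall>t\<in>{0..T}. norm (W t) \<le> K"
    by (auto simp: bounded_iff dest!: compact_imp_bounded)
  then have K: "\<And>t. t \<in> {0..T} \<Longrightarrow> norm (W t) \<le> K" by blast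
  define Q where "Q = \<bar>K\<bar> + norm m + 1"
  define B where "B = exp ((1 + Q) * \<bar>T\<bar>) * ((norm a)\<^sup>2 + (norm b)\<^sup>2)"
  have "norm (f l t) \<le> sqrt B" if l: "norm (l - m) \<le> 1" and t: "0 \<le> t" "t \<le> T" for l t
  proof -
    have Q: "norm (W u - l) \<le> Q" if "0 \<le> u" "u \<le> T" for u
      using K[of u] that l norm_triangle_ineq4[of "W u" l] norm_triangle_ineq[of "l - m" m]
      by (simp add: Q_def)
    have "(norm (f l t))\<^sup>2 \<le> (norm (f l t))\<^sup>2 + (norm (f1 l t))\<^sup>2" by simp
    also have "\<dots> \<le> exp ((1 + Q) * t) * ((norm (f l 0))\<^sup>2 + (norm (f1 l 0))\<^sup>2)"
      using f Q t by (intro linear_ode_energy_bound[of T]) auto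
    also have "\<dots> \<le> B"
      unfolding B_def f0 using t by (intro mult_right_mono) (auto simp: Q_def intro!: mult_mono)
    finally show ?thesis by (simp add: real_le_rsqrt)
  qed
  moreover have "sqrt B \<ge> 0" by (simp add: B_def)
  ultimately show ?thesis by blast
qed

text \<open>Caratheodory's criterion: \<open>spectral_difference\<close> exhibits the difference
  quotient, and only its continuity at m remains. The same identity, combined with local
  boundedness, yields the Lipschitz estimate \<open>lip\<close>, uniform in u, under which the
  integrals are continuous.\<close>

lemma sol_has_field_derivative:
  fixes f f1 :: "complex \<Rightarrow> real \<Rightarrow> complex"
  assumes f: "\<And>l t. (f l has_vector_derivative f1 l t) (at t)"
      "\<And>l t. (f1 l has_vector_derivative (W t - l) * f l t) (at t)"
    and f0: "\<And>l. f l 0 = a" "\<And>l. f1 l 0 = b" and t: "0 \<le> t"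
  shows "((\<lambda>l. f l t) has_field_derivative
           c m t * integral {0..t} (\<lambda>u. f m u * s m u) - s m t * integral {0..t} (\<lambda>u. f m u * c m u)) (at m)"
    and "((\<lambda>l. f1 l t) has_field_derivative
           c1 m t * integral {0..t} (\<lambda>u. f m u * s m u) - s1 m t * integral {0..t} (\<lambda>u. f m u * c m u)) (at m)"
proof -
  have contf: "continuous_on A (f l)" for A l
    by (meson f(1) continuous_at_imp_continuous_on has_vector_derivative_continuous)
  obtain B where B: "B \<ge> 0" "\<And>l u. norm (l - m) \<le> 1 \<Longrightarrow> 0 \<le> u \<Longrightarrow> u \<le> t \<Longrightarrow> norm (f l u) \<le> B"
    using sol_locally_bounded[OF f f0] by meson
  obtain Bc where Bc: "Bc \<ge> 0" "\<And>u. 0 \<le> u \<Longrightarrow> u \<le> t \<Longrightarrow> norm (c m u) \<le> Bc"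
    using sol_locally_bounded[OF c c1 c0, of m t] by fastforce
  obtain Bs where Bs: "Bs \<ge> 0" "\<And>u. 0 \<le> u \<Longrightarrow> u \<le> t \<Longrightarrow> norm (s m u) \<le> Bs"
    using sol_locally_bounded[OF s s1 s0, of m t] by fastforce
  define L where "L = Bc * (t * (B * Bs)) + Bs * (t * (B * Bc))"
  have lip: "norm (f l u - f m u) \<le> L * norm (l - m)" if l: "norm (l - m) \<le> 1" and u: "0 \<le> u" "u \<le> t" for l u
  proof -
    have "norm (integral {0..u} (\<lambda>v. f l v * s m v)) \<le> u * (B * Bs)"
      using B Bs l u by (intro norm_integral_le continuous_intros contf cont) (auto simp: norm_mult intro!: mult_mono)
    also have "\<dots> \<le> t * (B * Bs)" using u B Bs by (intro mult_right_mono) auto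
    finally have 1: "norm (integral {0..u} (\<lambda>v. f l v * s m v)) \<le> t * (B * Bs)" .
    have "norm (integral {0..u} (\<lambda>v. f l v * c m v)) \<le> u * (B * Bc)"
      using B Bc l u by (intro norm_integral_le continuous_intros contf cont) (auto simp: norm_mult intro!: mult_mono)
    also have "\<dots> \<le> t * (B * Bc)" using u B Bc by (intro mult_right_mono) auto
    finally have 2: "norm (integral {0..u} (\<lambda>v. f l v * c m v)) \<le> t * (B * Bc)" .
    have "norm (c m u * integral {0..u} (\<lambda>v. f l v * s m v) - s m u * integral {0..u} (\<lambda>v. f l v * c m v)) \<le> L"
      unfolding L_def using Bc Bs u B t
      by (intro norm_triangle_le_diff add_mono) (auto simp: norm_mult intro!: mult_mono 1 2)
    then show ?thesis
      unfolding spectral_difference(1)[OF f f0 u(1)] norm_mult by (intro mult_right_mono) auto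
  qed
  have int: "isCont (\<lambda>l. integral {0..t} (\<lambda>u. f l u * g u)) m"
    if g: "continuous_on {0..t} g" "K \<ge> 0" "\<And>u. 0 \<le> u \<Longrightarrow> u \<le> t \<Longrightarrow> norm (g u) \<le> K" for g K
  proof -
    have "((\<lambda>l. integral {0..t} (\<lambda>u. f l u * g u) - integral {0..t} (\<lambda>u. f m u * g u)) \<longlongrightarrow> 0) (at m)"
    proof (rule Lim_null_comparison)
      have "\<forall>\<^sub>F l in at m. norm (l - m) < 1"
        by (auto simp: eventually_at dist_norm intro!: exI[of _ 1])
      then show "\<forall>\<^sub>F l in at m. norm (integral {0..t} (\<lambda>u. f l u * g u) - integral {0..t} (\<lambda>u. f m u * g u)) \<le> t * (L * norm (l - m) * K)"
      proof eventually_elim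
        case (elim l)
        have "integral {0..t} (\<lambda>u. f l u * g u) - integral {0..t} (\<lambda>u. f m u * g u) = integral {0..t} (\<lambda>u. (f l u - f m u) * g u)"
          by (subst Henstock_Kurzweil_Integration.integral_diff[symmetric])
             (auto intro!: integrable_continuous_interval continuous_intros contf g simp: algebra_simps)
        also have "norm \<dots> \<le> t * (L * norm (l - m) * K)"
          using lip[of l] elim g t
          by (intro norm_integral_le continuous_intros contf) (auto simp: norm_mult intro!: mult_mono order_trans[OF norm_ge_zero])
        finally show ?case .
      qed
      show "((\<lambda>l. t * (L * norm (l - m) * K)) \<longlongrightarrow> 0) (at m)"
        by (auto intro!: tendsto_eq_intros)
    qed
    then show ?thesis unfolding isCont_def using LIM_zero_iff by blast
  qed
  note ints = int[OF cont(1) Bc] int[OF cont(3) Bs]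
  show "((\<lambda>l. f l t) has_field_derivative
           c m t * integral {0..t} (\<lambda>u. f m u * s m u) - s m t * integral {0..t} (\<lambda>u. f m u * c m u)) (at m)"
    unfolding CARAT_DERIV using ints
    by (intro exI[of _ "\<lambda>l. c m t * integral {0..t} (\<lambda>u. f l u * s m u) - s m t * integral {0..t} (\<lambda>u. f l u * c m u)"] conjI allI
        spectral_difference(1)[OF f f0 t] continuous_intros) auto
  show "((\<lambda>l. f1 l t) has_field_derivative
           c1 m t * integral {0..t} (\<lambda>u. f m u * s m u) - s1 m t * integral {0..t} (\<lambda>u. f m u * c m u)) (at m)"
    unfolding CARAT_DERIV using ints
    by (intro exI[of _ "\<lambda>l. c1 m t * integral {0..t} (\<lambda>u. f l u * s m u) - s1 m t * integral {0..t} (\<lambda>u. f l u * c m u)"] conjI allI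
        spectral_difference(2)[OF f f0 t] continuous_intros) auto
qed

lemma holomorphic:
  assumes "0 \<le> t"
  shows "(\<lambda>l. c l t) holomorphic_on A" "(\<lambda>l. c1 l t) holomorphic_on A"
    "(\<lambda>l. s l t) holomorphic_on A" "(\<lambda>l. s1 l t) holomorphic_on A"
proof -
  have h: "F holomorphic_on A" if "\<And>m. (F has_field_derivative d m) (at m)" for F d
    using that by (auto simp: holomorphic_on_def field_differentiable_def intro: has_field_derivative_at_within)
  show "(\<lambda>l. c l t) holomorphic_on A" "(\<lambda>l. c1 l t) holomorphic_on A"
    "(\<lambda>l. s l t) holomorphic_on A" "(\<lambda>l. s1 l t) holomorphic_on A"
    by (rule h, rule sol_has_field_derivative[OF c c1 c0 assms] sol_has_field_derivative[OF s s1 s0 assms])+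
qed

end

subsection \<open>Asymptotics for large spectral parameter\<close>

lemma norm_trig_le_exp:
  fixes k :: complex and t T :: real
  assumes "\<bar>t\<bar> \<le> T"
  shows "norm (sin (k * of_real t)) \<le> exp (\<bar>Im k\<bar> * T)"
    and "norm (cos (k * of_real t)) \<le> exp (\<bar>Im k\<bar> * T)"
proof -
  have "exp \<bar>Im (k * of_real t)\<bar> \<le> exp (\<bar>Im k\<bar> * T)"
    using assms by (simp add: abs_mult mult_left_mono)
  then show "norm (sin (k * of_real t)) \<le> exp (\<bar>Im k\<bar> * T)"
    "norm (cos (k * of_real t)) \<le> exp (\<bar>Im k\<bar> * T)"
    using cmod_sin_le_exp[of 1 "k * of_real t"] cmod_cos_le_exp[of 1 "k * of_real t"]
    by (simp_all only: scaleR_one) (meson exp_le_cancel_iff order_trans zero_le_one order_refl)+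
qed

lemma trig_kernel_derivative:
  fixes k :: complex and a b u :: real
  shows
  "((\<lambda>u. sin (k * of_real (a + b * u))) has_vector_derivative k * of_real b * cos (k * of_real (a + b * u))) (at u)"
  "((\<lambda>u. cos (k * of_real (a + b * u))) has_vector_derivative - (k * of_real b * sin (k * of_real (a + b * u)))) (at u)"
proof -
  have "((\<lambda>z. sin (k * (of_real a + of_real b * z))) has_field_derivative
      k * of_real b * cos (k * of_real (a + b * u))) (at (of_real u))"
    "((\<lambda>z. cos (k * (of_real a + of_real b * z))) has_field_derivative
      - (k * of_real b * sin (k * of_real (a + b * u)))) (at (of_real u))"
    by (auto intro!: derivative_eq_intros)
  from this[THEN has_vector_derivative_real_field]
  show "((\<lambda>u. sin (k * of_real (a + b * u))) has_vector_derivative k * of_real b * cos (k * of_real (a + b * u))) (at u)"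
  "((\<lambda>u. cos (k * of_real (a + b * u))) has_vector_derivative - (k * of_real b * sin (k * of_real (a + b * u)))) (at u)"
    by simp_all
qed

text \<open>Duhamel's formula for f'' + k^2 f = W f + g, obtained by recognising each integrand as a
  total derivative. The source g will be 0 for c and s, and W' s for d.\<close>

lemma variation_of_constants:
  fixes f f1 g W :: "real \<Rightarrow> complex"
  assumes t: "0 \<le> t"
    and f: "\<And>u. 0 \<le> u \<Longrightarrow> u \<le> t \<Longrightarrow> (f has_vector_derivative f1 u) (at u)"
    and f1: "\<And>u. 0 \<le> u \<Longrightarrow> u \<le> t \<Longrightarrow> (f1 has_vector_derivative (W u - k\<^sup>2) * f u + g u) (at u)"
  shows "((\<lambda>u. sin (k * of_real (t - u)) * (W u * f u + g u)) has_integral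
            (k * f t - k * cos (k * of_real t) * f 0 - sin (k * of_real t) * f1 0)) {0..t}"
    and "((\<lambda>u. cos (k * of_real (t - u)) * (W u * f u + g u)) has_integral
            (f1 t + k * sin (k * of_real t) * f 0 - cos (k * of_real t) * f1 0)) {0..t}"
proof -
  let ?S = "\<lambda>u. sin (k * of_real (t - u))" and ?C = "\<lambda>u. cos (k * of_real (t - u))"
  have S: "(?S has_vector_derivative - (k * ?C u)) (at u)"
    and C: "(?C has_vector_derivative k * ?S u) (at u)" for u
    using trig_kernel_derivative[of k t "-1" u] by simp_all
  have "((\<lambda>u. k * (?C u * f u) + ?S u * f1 u) has_vector_derivative
      k * (?C u * f1 u + k * ?S u * f u) + (?S u * ((W u - k\<^sup>2) * f u + g u) + - (k * ?C u) * f1 u)) (at u)"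
    if "0 \<le> u" "u \<le> t" for u
    by (intro has_vector_derivative_add has_vector_derivative_mult has_vector_derivative_mult_right S C f f1 that)
  moreover have "k * (?C u * f1 u + k * ?S u * f u) + (?S u * ((W u - k\<^sup>2) * f u + g u) + - (k * ?C u) * f1 u)
     = ?S u * (W u * f u + g u)" for u
    by (simp add: algebra_simps power2_eq_square)
  ultimately have "((\<lambda>u. k * (?C u * f u) + ?S u * f1 u) has_vector_derivative ?S u * (W u * f u + g u)) (at u)"
    if "0 \<le> u" "u \<le> t" for u using that by simp
  from has_integral_vector_derivative[OF t this]
  show "((\<lambda>u. sin (k * of_real (t - u)) * (W u * f u + g u)) has_integral
            (k * f t - k * cos (k * of_real t) * f 0 - sin (k * of_real t) * f1 0)) {0..t}"
    by (simp add: algebra_simps)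
  have "((\<lambda>u. ?C u * f1 u - k * (?S u * f u)) has_vector_derivative
      (?C u * ((W u - k\<^sup>2) * f u + g u) + k * ?S u * f1 u) - k * (?S u * f1 u + - (k * ?C u) * f u)) (at u)"
    if "0 \<le> u" "u \<le> t" for u
    by (intro has_vector_derivative_diff has_vector_derivative_mult has_vector_derivative_mult_right S C f f1 that)
  moreover have "(?C u * ((W u - k\<^sup>2) * f u + g u) + k * ?S u * f1 u) - k * (?S u * f1 u + - (k * ?C u) * f u)
     = ?C u * (W u * f u + g u)" for u
    by (simp add: algebra_simps power2_eq_square)
  ultimately have "((\<lambda>u. ?C u * f1 u - k * (?S u * f u)) has_vector_derivative ?C u * (W u * f u + g u)) (at u)"
    if "0 \<le> u" "u \<le> t" for u using that by simp
  from has_integral_vector_derivative[OF t this]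
  show "((\<lambda>u. cos (k * of_real (t - u)) * (W u * f u + g u)) has_integral
            (f1 t + k * sin (k * of_real t) * f 0 - cos (k * of_real t) * f1 0)) {0..t}"
    by (simp add: algebra_simps)
qed

lemma kernel_integral_bound:
  fixes K h :: "real \<Rightarrow> complex"
  assumes I: "((\<lambda>u. K u * h u) has_integral I) {0..t}" and t: "0 \<le> t" and H: "0 \<le> H"
    and K: "\<And>u. 0 \<le> u \<Longrightarrow> u \<le> t \<Longrightarrow> norm (K u) \<le> exp (a * (t - u))"
    and h: "\<And>u. 0 \<le> u \<Longrightarrow> u \<le> t \<Longrightarrow> norm (h u) \<le> H * exp (a * u)"
  shows "norm I \<le> t * H * exp (a * t)"
proof -
  have "norm I \<le> H * exp (a * t) * measure lborel (cbox 0 t)"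
  proof (rule has_integral_bound[of _ "\<lambda>u. K u * h u"])
    fix u assume u: "u \<in> cbox 0 t"
    have "norm (K u * h u) \<le> exp (a * (t - u)) * (H * exp (a * u))"
      unfolding norm_mult using K[of u] h[of u] u by (intro mult_mono) auto
    also have "\<dots> = H * exp (a * t)" by (simp add: mult_exp_exp algebra_simps)
    finally show "norm (K u * h u) \<le> H * exp (a * t)" .
  qed (use I H in auto)
  then show ?thesis using t by (simp add: algebra_simps)
qed

text \<open>Instead of iterating the Volterra equation, the weighted modulus \<open>F\<close> is
  taken at its maximum m: the homogeneous part of the integral is at most T M F(m), and
  \<open>2 * T * M \<le> norm k\<close> lets half of |k| F(m) absorb it.\<close>

lemma volterra_bound:
  fixes f f1 g W :: "real \<Rightarrow> complex"
  assumes T: "0 \<le> T" and k: "k \<noteq> 0" "2 * T * M \<le> norm k"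
    and f: "\<And>u. 0 \<le> u \<Longrightarrow> u \<le> T \<Longrightarrow> (f has_vector_derivative f1 u) (at u)"
    and f1: "\<And>u. 0 \<le> u \<Longrightarrow> u \<le> T \<Longrightarrow> (f1 has_vector_derivative (W u - k\<^sup>2) * f u + g u) (at u)"
    and W: "\<And>u. 0 \<le> u \<Longrightarrow> u \<le> T \<Longrightarrow> norm (W u) \<le> M"
    and g: "\<And>u. 0 \<le> u \<Longrightarrow> u \<le> T \<Longrightarrow> norm (g u) \<le> G * exp (\<bar>Im k\<bar> * u)"
    and t: "0 \<le> t" "t \<le> T"
  shows "norm (f t) \<le> 2 * (norm (f 0) + norm (f1 0) / norm k + T * G / norm k) * exp (\<bar>Im k\<bar> * t)"
proof -
  let ?a = "\<bar>Im k\<bar>"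
  define F where "F u = norm (f u) * exp (- (?a * u))" for u
  have "continuous_on {0..T} f"
    by (meson f atLeastAtMost_iff continuous_at_imp_continuous_on has_vector_derivative_continuous)
  then have "continuous_on {0..T} F" unfolding F_def by (intro continuous_intros)
  then obtain m where m: "0 \<le> m" "m \<le> T" "\<And>u. 0 \<le> u \<Longrightarrow> u \<le> T \<Longrightarrow> F u \<le> F m"
    using continuous_attains_sup[of "{0..T}" F] T by auto
  have fF: "norm (f u) = F u * exp (?a * u)" for u
    by (simp add: F_def mult.assoc mult_exp_exp)
  have F0: "F u \<ge> 0" for u by (simp add: F_def)
  have M0: "M \<ge> 0" using W[of 0] T norm_ge_zero[of "W 0"] by linarith
  have G0: "G \<ge> 0" using g[of 0] T norm_ge_zero[of "g 0"] by (simp del: norm_ge_zero)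
  define I where "I = k * f m - k * cos (k * of_real m) * f 0 - sin (k * of_real m) * f1 0"
  have "norm I \<le> m * (M * F m + G) * exp (?a * m)"
  proof (rule kernel_integral_bound)
    show "((\<lambda>u. sin (k * of_real (m - u)) * (W u * f u + g u)) has_integral I) {0..m}"
      unfolding I_def using f f1 m by (intro variation_of_constants(1)) auto
    fix u assume u: "0 \<le> u" "u \<le> m"
    show "norm (sin (k * of_real (m - u))) \<le> exp (?a * (m - u))"
      using u by (intro norm_trig_le_exp) auto
    have "norm (W u * f u) \<le> M * (F m * exp (?a * u))"
      unfolding norm_mult fF using W[of u] m u M0 F0
      by (intro mult_mono) (auto intro!: mult_right_mono)
    then show "norm (W u * f u + g u) \<le> (M * F m + G) * exp (?a * u)"
      using g[of u] u m norm_triangle_ineq[of "W u * f u" "g u"] by (simp add: algebra_simps)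
  qed (use m M0 F0 G0 in auto)
  also have "\<dots> \<le> T * (M * F m + G) * exp (?a * m)"
    using m M0 F0 G0 by (intro mult_right_mono) auto
  finally have I: "norm I \<le> T * (M * F m + G) * exp (?a * m)" .
  have "k * f m = I + k * cos (k * of_real m) * f 0 + sin (k * of_real m) * f1 0"
    by (simp add: I_def)
  then have "norm (k * f m) \<le> norm I + norm (k * cos (k * of_real m) * f 0) + norm (sin (k * of_real m) * f1 0)"
    by (metis norm_triangle_le norm_triangle_ineq add_mono order_refl)
  also have "\<dots> \<le> T * (M * F m + G) * exp (?a * m) + norm k * exp (?a * m) * norm (f 0) + exp (?a * m) * norm (f1 0)"
    unfolding norm_mult using norm_trig_le_exp[of m m k] m
    by (intro add_mono I mult_mono) auto
  finally have "norm k * F m * exp (?a * m) \<le>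
      (T * (M * F m + G) + norm k * norm (f 0) + norm (f1 0)) * exp (?a * m)"
    by (simp add: norm_mult fF algebra_simps)
  then have 1: "norm k * F m \<le> T * (M * F m + G) + norm k * norm (f 0) + norm (f1 0)"
    by (simp only: mult_le_cancel_right) (meson exp_gt_zero not_less_iff_gr_or_eq)
  have "2 * T * M * F m \<le> norm k * F m" using k F0 by (intro mult_right_mono) auto
  with 1 have "norm k * F m \<le> 2 * (T * G + norm k * norm (f 0) + norm (f1 0))"
    by (simp add: algebra_simps)
  then have "F m \<le> 2 * (norm (f 0) + norm (f1 0) / norm k + T * G / norm k)"
    using k by (simp add: field_simps)
  then have "F t \<le> 2 * (norm (f 0) + norm (f1 0) / norm k + T * G / norm k)"
    using m(3)[OF t] by linarith
  then show ?thesis unfolding fF by (intro mult_right_mono) auto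
qed

lemma continuous_on_bounded_interval:
  fixes f :: "real \<Rightarrow> complex"
  assumes "continuous_on {0..T} f"
  shows "\<exists>B\<ge>0. \<forall>u. 0 \<le> u \<longrightarrow> u \<le> T \<longrightarrow> norm (f u) \<le> B"
proof -
  have "compact (f ` {0..T})" by (intro compact_continuous_image assms) auto
  then obtain B where "B > 0" "\<forall>u\<in>{0..T}. norm (f u) \<le> B"
    by (auto simp: bounded_pos dest!: compact_imp_bounded)
  then show ?thesis by (intro exI[of _ B]) auto
qed

text \<open>The Riemann-Lebesgue lemma, uniform in complex frequencies after normalisation by the
  exponential growth of the kernel.\<close>
lemma riemann_lebesgue:
  fixes w :: "real \<Rightarrow> complex"
  assumes w: "continuous_on {0..pi} w" and e: "0 < e"
  shows "\<exists>K\<ge>1. \<forall>k::complex. norm k \<ge> K \<longrightarrow>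
    norm (integral {0..pi} (\<lambda>u. sin (k * of_real (pi - 2 * u)) * w u)) \<le> e * exp (\<bar>Im k\<bar> * pi)"
proof -
  \<comment> \<open>Replacing w by a polynomial permits integration by parts. The tolerance e / (2
    pi), over an interval of length pi, spends half of e.\<close>
  obtain p where p: "polynomial_function p" "\<And>u. u \<in> {0..pi} \<Longrightarrow> norm (w u - p u) < e / (2 * pi)"
    using Stone_Weierstrass_polynomial_function[OF _ w, of "e / (2 * pi)"] e by auto
  obtain p' where p': "polynomial_function p'" "\<And>u. (p has_vector_derivative p' u) (at u)"
    using has_vector_derivative_polynomial_function[OF p(1)] by blast
  have cp: "continuous_on A p" and cp': "continuous_on A p'" for A
    using p p' by (auto intro: continuous_on_polymonial_function)
  obtain B where B: "B \<ge> 0" "\<And>u. 0 \<le> u \<Longrightarrow> u \<le> pi \<Longrightarrow> norm (p u) \<le> B"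
    using continuous_on_bounded_interval[OF cp] by meson
  obtain B' where B': "B' \<ge> 0" "\<And>u. 0 \<le> u \<Longrightarrow> u \<le> pi \<Longrightarrow> norm (p' u) \<le> B'"
    using continuous_on_bounded_interval[OF cp'] by meson
  \<comment> \<open>The two boundary terms give 2 B and the remaining integral pi B'; beyond this K
    their sum divided by 2 |k| is at most e / 2.\<close>
  define K where "K = max 1 ((2 * B + pi * B') / e)"
  have "norm (integral {0..pi} (\<lambda>u. sin (k * of_real (pi - 2 * u)) * w u)) \<le> e * exp (\<bar>Im k\<bar> * pi)"
    if K: "norm k \<ge> K" for k :: complex
  proof -
    let ?E = "exp (\<bar>Im k\<bar> * pi)"
    have k: "k \<noteq> 0" "norm k > 0" using K by (auto simp: K_def)
    let ?S = "\<lambda>u. sin (k * of_real (pi - 2 * u))" and ?C = "\<lambda>u. cos (k * of_real (pi - 2 * u))"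
    have S: "continuous_on A ?S" "continuous_on A ?C" for A by (intro continuous_intros)+
    have bd: "norm (?S u) \<le> ?E" "norm (?C u) \<le> ?E" if "0 \<le> u" "u \<le> pi" for u
      using that norm_trig_le_exp[of "pi - 2 * u" pi k] by auto
    have C: "(?C has_vector_derivative 2 * k * ?S u) (at u)" for u
      using trig_kernel_derivative(2)[of k pi "-2" u] by (simp add: mult_ac)
    have "((\<lambda>u. ?C u * p u) has_vector_derivative ?C u * p' u + 2 * k * ?S u * p u) (at u)" for u
      by (intro has_vector_derivative_mult C p')
    from has_integral_vector_derivative[OF pi_ge_zero this]
    have 1: "((\<lambda>u. ?C u * p' u + 2 * k * ?S u * p u) has_integral (?C pi * p pi - ?C 0 * p 0)) {0..pi}" .
    have 2: "((\<lambda>u. ?C u * p' u) has_integral integral {0..pi} (\<lambda>u. ?C u * p' u)) {0..pi}"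
      by (intro integrable_integral integrable_continuous_interval continuous_intros S cp')
    have 3: "((\<lambda>u. 2 * k * (?S u * p u)) has_integral
        (?C pi * p pi - ?C 0 * p 0 - integral {0..pi} (\<lambda>u. ?C u * p' u))) {0..pi}"
      using has_integral_diff[OF 1 2] by (simp add: mult.assoc)
    have eq: "2 * k * integral {0..pi} (\<lambda>u. ?S u * p u) =
      ?C pi * p pi - ?C 0 * p 0 - integral {0..pi} (\<lambda>u. ?C u * p' u)"
      using integral_unique[OF 3] by simp
    have b2: "norm (integral {0..pi} (\<lambda>u. ?C u * p' u)) \<le> (?E * B') * (pi - 0)"
      using bd B' by (intro integral_bound continuous_intros S cp') (auto simp: norm_mult intro!: mult_mono)
    have "2 * norm k * norm (integral {0..pi} (\<lambda>u. ?S u * p u)) = norm (2 * k * integral {0..pi} (\<lambda>u. ?S u * p u))"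
      by (simp add: norm_mult)
    also have "\<dots> \<le> norm (?C pi * p pi) + norm (?C 0 * p 0) + norm (integral {0..pi} (\<lambda>u. ?C u * p' u))"
      unfolding eq by (meson norm_triangle_le_diff add_mono order_refl norm_triangle_ineq4 order_trans)
    also have "\<dots> \<le> ?E * B + ?E * B + ?E * B' * (pi - 0)"
      unfolding norm_mult using bd[of 0] bd[of pi] B by (intro add_mono b2 mult_mono) (simp_all del: of_real_diff)
    finally have "2 * norm k * norm (integral {0..pi} (\<lambda>u. ?S u * p u)) \<le> ?E * (2 * B + pi * B')"
      by (simp add: algebra_simps)
    also have "\<dots> \<le> ?E * (e * norm k)"
      using K e by (intro mult_left_mono) (auto simp: K_def field_simps)
    finally have "norm k * (2 * norm (integral {0..pi} (\<lambda>u. ?S u * p u))) \<le> norm k * (?E * e)"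
      by (simp add: algebra_simps)
    then have A: "norm (integral {0..pi} (\<lambda>u. ?S u * p u)) \<le> ?E * e / 2"
      using k by (simp only: mult_le_cancel_left_pos)
    have Bd: "norm (integral {0..pi} (\<lambda>u. ?S u * (w u - p u))) \<le> (?E * (e / (2 * pi))) * (pi - 0)"
    proof (intro integral_bound continuous_intros S cp w)
      fix u assume u: "u \<in> {0..pi}"
      show "norm (?S u * (w u - p u)) \<le> ?E * (e / (2 * pi))"
        unfolding norm_mult by (rule mult_mono) (use bd[of u] p(2)[OF u] u in \<open>auto simp del: of_real_diff\<close>)
    qed auto
    have "integral {0..pi} (\<lambda>u. ?S u * w u) = integral {0..pi} (\<lambda>u. ?S u * (w u - p u)) + integral {0..pi} (\<lambda>u. ?S u * p u)"
      by (subst Henstock_Kurzweil_Integration.integral_add[symmetric])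
         (auto intro!: integrable_continuous_interval continuous_intros S w cp simp: algebra_simps)
    then have "norm (integral {0..pi} (\<lambda>u. ?S u * w u)) \<le> (?E * (e / (2 * pi))) * (pi - 0) + ?E * e / 2"
      using A Bd by (simp only:) (meson add_mono norm_triangle_ineq order_trans)
    then show ?thesis by (simp add: field_simps)
  qed
  moreover have "K \<ge> 1" by (simp add: K_def)
  ultimately show ?thesis by blast
qed

text \<open>Both follow from |sin z|^2 = sin^2(Re z) + sinh^2(Im z) by dropping one of the
  terms.\<close>

lemma norm_sin_lower_bounds:
  fixes z :: complex
  shows "\<bar>sin (Re z)\<bar> \<le> norm (sin z)" "exp \<bar>Im z\<bar> - exp (- \<bar>Im z\<bar>) \<le> 2 * norm (sin z)"
proof -
  define y where "y = \<bar>Im z\<bar>"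
  have "4 * (norm (sin z))\<^sup>2 = exp (2 * y) + exp (- (2 * y)) - 2 * cos (2 * Re z)"
    unfolding norm_sin_squared y_def by (cases "Im z \<ge> 0") (auto simp: exp_minus)
  also have "\<dots> = (exp y - exp (- y))\<^sup>2 + 4 * (sin (Re z))\<^sup>2"
  proof -
    have "exp (2 * y) = exp y * exp y" "exp (- (2 * y)) = exp (- y) * exp (- y)" "exp y * exp (- y) = 1"
      by (simp_all add: mult_exp_exp)
    then show ?thesis using cos_double_sin[of "Re z"] by (simp add: power2_eq_square algebra_simps)
  qed
  finally have *: "4 * (norm (sin z))\<^sup>2 = (exp y - exp (- y))\<^sup>2 + 4 * (sin (Re z))\<^sup>2" .
  then have "(sin (Re z))\<^sup>2 \<le> (norm (sin z))\<^sup>2" using zero_le_power2[of "exp y - exp (- y)"] by linarith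
  then show "\<bar>sin (Re z)\<bar> \<le> norm (sin z)" using abs_le_square_iff[of "sin (Re z)" "norm (sin z)"] by simp
  have "(exp y - exp (- y))\<^sup>2 \<le> (2 * norm (sin z))\<^sup>2" using * by (simp add: power_mult_distrib)
  then have "exp y - exp (- y) \<le> 2 * norm (sin z)" by (rule power2_le_imp_le) simp
  then show "exp \<bar>Im z\<bar> - exp (- \<bar>Im z\<bar>) \<le> 2 * norm (sin z)" by (simp add: y_def)
qed

text \<open>The half-integer radius keeps k away from the integers. If |Im k| is at least 1/4, the
  sinh part suffices; otherwise |Re k| lies within 1/8 of n + 1/2, so the sine has modulus at least
  1/2 while the exponential is at most 3.\<close>

lemma sin_lower_bound_on_circle:
  fixes k :: complex and n :: nat
  assumes k: "norm k = real n + 1/2"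
  shows "exp (\<bar>Im k\<bar> * pi) \<le> 8 * norm (sin (k * of_real pi))"
proof (cases "\<bar>Im k\<bar> \<ge> 1/4")
  case True
  define y where "y = \<bar>Im k\<bar> * pi"
  have y: "y \<ge> 3/4" using mult_mono[OF True, of 3 pi] pi_gt3 by (simp add: y_def)
  have "1 + 2 * y \<le> exp (2 * y)" by (rule exp_ge_add_one_self)
  then have "2 \<le> exp (2 * y)" using y by linarith
  also have "exp (2 * y) = exp y * exp y" by (simp add: mult_exp_exp)
  finally have "2 * exp (- y) \<le> (exp y * exp y) * exp (- y)" by (intro mult_right_mono) auto
  also have "\<dots> = exp y" by (simp add: mult_exp_exp)
  finally have "2 * exp (- y) \<le> exp y" .
  moreover have "exp y - exp (- y) \<le> 2 * norm (sin (k * of_real pi))"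
    using norm_sin_lower_bounds(2)[of "k * of_real pi"] by (simp add: y_def abs_mult)
  ultimately have "exp y \<le> 8 * norm (sin (k * of_real pi))" using exp_gt_zero[of "-y"] by linarith
  then show ?thesis by (simp add: y_def)
next
  case False
  define r where "r = \<bar>Re k\<bar>"
  have "(norm k)\<^sup>2 = r\<^sup>2 + (Im k)\<^sup>2" by (simp add: cmod_power2 r_def)
  moreover have "(Im k)\<^sup>2 \<le> 1/16"
    using False abs_le_square_iff[of "Im k" "1/4"] by (simp add: power2_eq_square)
  ultimately have r2: "(real n + 1/2)\<^sup>2 - 1/16 \<le> r\<^sup>2" using k by simp
  have "(real n + 1/2 - 1/8)\<^sup>2 \<le> (real n + 1/2)\<^sup>2 - 1/16"
    by (simp add: power2_eq_square algebra_simps)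
  with r2 have "(real n + 1/2 - 1/8)\<^sup>2 \<le> r\<^sup>2" by linarith
  then have r_ge: "real n + 1/2 - 1/8 \<le> r" by (rule power2_le_imp_le) (simp add: r_def)
  have r_le: "r \<le> real n + 1/2" using abs_Re_le_cmod[of k] k by (simp add: r_def)
  define y where "y = real n + 1/2 - r"
  have y: "0 \<le> y" "y \<le> 1/8" using r_ge r_le by (auto simp: y_def)
  have "sin (r * pi) = sin ((real n * pi + pi / 2) - y * pi)" by (simp add: y_def algebra_simps)
  also have "\<dots> = cos (real n * pi) * cos (y * pi)"
    by (simp add: sin_diff sin_add cos_add)
  finally have "\<bar>sin (r * pi)\<bar> = \<bar>cos (y * pi)\<bar>" by (simp add: abs_mult cos_npi)
  moreover have "cos (pi / 3) \<le> cos (y * pi)"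
    using y pi_gt_zero mult_right_mono[of y "1/8" pi] by (intro cos_monotone_0_pi_le) auto
  ultimately have "\<bar>sin (r * pi)\<bar> \<ge> 1/2" by (simp add: cos_60)
  moreover have "\<bar>sin (Re k * pi)\<bar> = \<bar>sin (r * pi)\<bar>"
    by (cases "Re k \<ge> 0") (auto simp: r_def)
  ultimately have 1: "norm (sin (k * of_real pi)) \<ge> 1/2"
    using norm_sin_lower_bounds(1)[of "k * of_real pi"] by simp
  have "exp (\<bar>Im k\<bar> * pi) \<le> exp 1"
    using mult_mono[of "\<bar>Im k\<bar>" "1/4" pi 4] pi_less_4 False by simp
  also have "exp 1 \<le> (3::real)" by (rule exp_le)
  finally show ?thesis using 1 by linarith
qed

section \<open>Estimates for Hill's equation with a continuously differentiable potential\<close>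

locale hill_system = fundamental_system +
  fixes W' :: "real \<Rightarrow> complex"
  assumes dW: "\<And>t. (W has_vector_derivative W' t) (at t)" and contW': "continuous_on UNIV W'"
    and per: "W pi = W 0"
begin

lemma W_bounds: "\<exists>M\<ge>1. \<forall>u. 0 \<le> u \<longrightarrow> u \<le> pi \<longrightarrow> norm (W u) \<le> M \<and> norm (W' u) \<le> M"
proof -
  obtain A B where "\<And>u. 0 \<le> u \<Longrightarrow> u \<le> pi \<Longrightarrow> norm (W u) \<le> A"
    "\<And>u. 0 \<le> u \<Longrightarrow> u \<le> pi \<Longrightarrow> norm (W' u) \<le> B"
    using continuous_on_bounded_interval[of pi W] continuous_on_bounded_interval[of pi W'] contW contW'
    by (meson continuous_on_subset subset_UNIV)
  then show ?thesis
    by (intro exI[of _ "max 1 (max A B)"]) (auto simp: le_max_iff_disj)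
qed

text \<open>Inserting the bound of \<open>volterra_bound\<close> for c into the Duhamel integral for
  c1 leaves an error one power of k below the main term. This precision serves for lower bounds on
  the circles and for counting zeros.\<close>

lemma c1_asymptotics:
  "\<exists>C>0. \<exists>K\<ge>1. \<forall>k. norm k \<ge> K \<longrightarrow>
     norm (c1 (k\<^sup>2) pi + k * sin (k * of_real pi)) \<le> C * exp (\<bar>Im k\<bar> * pi)"
proof -
  obtain M where M: "M \<ge> 1" "\<And>u. 0 \<le> u \<Longrightarrow> u \<le> pi \<Longrightarrow> norm (W u) \<le> M"
    using W_bounds by blast
  have "norm (c1 (k\<^sup>2) pi + k * sin (k * of_real pi)) \<le> (2 * pi * M) * exp (\<bar>Im k\<bar> * pi)"
    if k: "norm k \<ge> 2 * pi * M" for k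
  proof -
    have "0 < 2 * pi * M" using M by simp
    with k have k0: "k \<noteq> 0" by auto
    have cb: "norm (c (k\<^sup>2) t) \<le> 2 * exp (\<bar>Im k\<bar> * t)" if "0 \<le> t" "t \<le> pi" for t
      using volterra_bound[OF pi_ge_zero k0 k, of "c (k\<^sup>2)" "c1 (k\<^sup>2)" W "\<lambda>_. 0" 0 t]
        c c1 M that c0 by simp
    have "norm (c1 (k\<^sup>2) pi + k * sin (k * of_real pi) * c (k\<^sup>2) 0 - cos (k * of_real pi) * c1 (k\<^sup>2) 0)
       \<le> pi * (2 * M) * exp (\<bar>Im k\<bar> * pi)"
    proof (rule kernel_integral_bound)
      show "((\<lambda>u. cos (k * of_real (pi - u)) * (W u * c (k\<^sup>2) u + 0)) has_integral
         (c1 (k\<^sup>2) pi + k * sin (k * of_real pi) * c (k\<^sup>2) 0 - cos (k * of_real pi) * c1 (k\<^sup>2) 0)) {0..pi}"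
        by (rule variation_of_constants(2)) (use c c1 in auto)
      fix u :: real assume u: "0 \<le> u" "u \<le> pi"
      show "norm (cos (k * of_real (pi - u))) \<le> exp (\<bar>Im k\<bar> * (pi - u))"
        using u by (intro norm_trig_le_exp) auto
      have "norm (W u * c (k\<^sup>2) u) \<le> M * (2 * exp (\<bar>Im k\<bar> * u))"
        unfolding norm_mult using M cb u by (intro mult_mono) auto
      then show "norm (W u * c (k\<^sup>2) u + 0) \<le> 2 * M * exp (\<bar>Im k\<bar> * u)" by simp
    qed (use M in auto)
    then show ?thesis by (simp add: c0 mult_ac)
  qed
  moreover have "2 * pi * M \<ge> 1" using mult_mono[of 1 "2 * pi" 1 M] pi_gt3 M by simp
  moreover have "2 * pi * M > 0" using M by simp
  ultimately show ?thesis by blast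
qed

text \<open>The leading trigonometric terms of s1 and c cancel in d, as do those of c1 and (l - W) s
  in h; for W = 0 both vanish identically.\<close>

definition d :: "complex \<Rightarrow> real \<Rightarrow> complex" where "d l t = s1 l t - c l t"
definition h :: "complex \<Rightarrow> real \<Rightarrow> complex" where "h l t = c1 l t + (l - W t) * s l t"

lemma d_derivative: "(d l has_vector_derivative - h l t) (at t)"
proof -
  have "(d l has_vector_derivative (W t - l) * s l t - c1 l t) (at t)"
    unfolding d_def[abs_def] by (intro has_vector_derivative_diff s1 c)
  then show ?thesis by (simp add: h_def algebra_simps)
qed

text \<open>Differentiating the coefficient l - W brings in W'; the other terms recombine into the
  homogeneous equation for d, so that W' s is the whole source.\<close>

lemma h_derivative: "((\<lambda>t. - h l t) has_vector_derivative (W t - l) * d l t + W' t * s l t) (at t)"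
proof -
  have "((\<lambda>t. l - W t) has_vector_derivative 0 - W' t) (at t)"
    by (intro has_vector_derivative_diff dW has_vector_derivative_const)
  then have "((\<lambda>t. - h l t) has_vector_derivative
      - ((W t - l) * c l t + ((l - W t) * s1 l t + (0 - W' t) * s l t))) (at t)"
    unfolding h_def by (intro has_vector_derivative_minus has_vector_derivative_add has_vector_derivative_mult c1 s)
  then show ?thesis by (simp add: d_def algebra_simps)
qed

lemma d_h_0: "d l 0 = 0" "h l 0 = 0" by (simp_all add: d_def h_def s0 c0)

text \<open>Up to the exponential, the source W' s is O(1/|k|), and \<open>volterra_bound\<close>
  divides by |k| once more; the initial values of d and h vanish. For s, the Duhamel integral gives
  an error of the same order.\<close>

lemma d_s_bounds:
  "\<exists>C>0. \<exists>K\<ge>1. \<forall>k. norm k \<ge> K \<longrightarrow> (\<forall>u. 0 \<le> u \<longrightarrow> u \<le> pi \<longrightarrow>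
      norm (d (k\<^sup>2) u) \<le> C / (norm k)\<^sup>2 * exp (\<bar>Im k\<bar> * u) \<and>
      norm (s (k\<^sup>2) u - sin (k * of_real u) / k) \<le> C / (norm k)\<^sup>2 * exp (\<bar>Im k\<bar> * u))"
proof -
  obtain M where M: "M \<ge> 1" "\<And>u. 0 \<le> u \<Longrightarrow> u \<le> pi \<Longrightarrow> norm (W u) \<le> M"
     "\<And>u. 0 \<le> u \<Longrightarrow> u \<le> pi \<Longrightarrow> norm (W' u) \<le> M"
    using W_bounds by blast
  have "norm (d (k\<^sup>2) t) \<le> 4 * pi * M / (norm k)\<^sup>2 * exp (\<bar>Im k\<bar> * t) \<and>
      norm (s (k\<^sup>2) t - sin (k * of_real t) / k) \<le> 4 * pi * M / (norm k)\<^sup>2 * exp (\<bar>Im k\<bar> * t)"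
    if k: "norm k \<ge> 2 * pi * M" and t: "0 \<le> t" "t \<le> pi" for k t
  proof -
    have "0 < 2 * pi * M" using M by simp
    with k have k0: "k \<noteq> 0" by auto
    have sb: "norm (s (k\<^sup>2) t) \<le> 2 / norm k * exp (\<bar>Im k\<bar> * t)" if "0 \<le> t" "t \<le> pi" for t
      using volterra_bound[OF pi_ge_zero k0 k, of "s (k\<^sup>2)" "s1 (k\<^sup>2)" W "\<lambda>_. 0" 0 t]
        s s1 M that s0 by simp
    have "norm (W' u * s (k\<^sup>2) u) \<le> M * (2 / norm k * exp (\<bar>Im k\<bar> * u))" if "0 \<le> u" "u \<le> pi" for u
      unfolding norm_mult using M(1) by (intro mult_mono M(3) sb that) auto
    then have "norm (d (k\<^sup>2) t) \<le> 2 * (norm (d (k\<^sup>2) 0) + norm (- h (k\<^sup>2) 0) / norm k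
        + pi * (2 * M / norm k) / norm k) * exp (\<bar>Im k\<bar> * t)"
      using volterra_bound[OF pi_ge_zero k0 k, of "d (k\<^sup>2)" "\<lambda>t. - h (k\<^sup>2) t" W "\<lambda>u. W' u * s (k\<^sup>2) u" "2 * M / norm k" t]
        d_derivative h_derivative M t by (simp add: mult_ac)
    then have 1: "norm (d (k\<^sup>2) t) \<le> 4 * pi * M / (norm k)\<^sup>2 * exp (\<bar>Im k\<bar> * t)"
      by (simp add: d_h_0 power2_eq_square mult_ac)
    have "norm (k * s (k\<^sup>2) t - k * cos (k * of_real t) * s (k\<^sup>2) 0 - sin (k * of_real t) * s1 (k\<^sup>2) 0)
       \<le> t * (2 * M / norm k) * exp (\<bar>Im k\<bar> * t)"
    proof (rule kernel_integral_bound)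
      show "((\<lambda>u. sin (k * of_real (t - u)) * (W u * s (k\<^sup>2) u + 0)) has_integral
         (k * s (k\<^sup>2) t - k * cos (k * of_real t) * s (k\<^sup>2) 0 - sin (k * of_real t) * s1 (k\<^sup>2) 0)) {0..t}"
        by (rule variation_of_constants(1)) (use s s1 t in auto)
      fix u :: real assume u: "0 \<le> u" "u \<le> t"
      show "norm (sin (k * of_real (t - u))) \<le> exp (\<bar>Im k\<bar> * (t - u))"
        using u by (intro norm_trig_le_exp) auto
      have "norm (W u * s (k\<^sup>2) u) \<le> M * (2 / norm k * exp (\<bar>Im k\<bar> * u))"
        unfolding norm_mult using M sb u t by (intro mult_mono) auto
      then show "norm (W u * s (k\<^sup>2) u + 0) \<le> 2 * M / norm k * exp (\<bar>Im k\<bar> * u)" by (simp add: mult_ac)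
    qed (use M t in auto)
    also have "\<dots> \<le> pi * (2 * M / norm k) * exp (\<bar>Im k\<bar> * t)"
      using M t by (intro mult_right_mono) auto
    \<comment> \<open>Doubling the constant lets d and s share one C.\<close>
    also have "\<dots> \<le> pi * (4 * M / norm k) * exp (\<bar>Im k\<bar> * t)"
      using M by (intro mult_right_mono mult_left_mono divide_right_mono) auto
    finally have "norm (k * s (k\<^sup>2) t - sin (k * of_real t)) \<le> pi * (4 * M / norm k) * exp (\<bar>Im k\<bar> * t)"
      by (simp add: s0)
    moreover have "k * s (k\<^sup>2) t - sin (k * of_real t) = k * (s (k\<^sup>2) t - sin (k * of_real t) / k)"
      using k0 by (simp add: field_simps)
    ultimately have "norm k * norm (s (k\<^sup>2) t - sin (k * of_real t) / k) \<le> pi * (4 * M / norm k) * exp (\<bar>Im k\<bar> * t)"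
      by (simp only: norm_mult)
    moreover have "y \<le> 4 * pi * M / (norm k)\<^sup>2 * b" if "norm k * y \<le> pi * (4 * M / norm k) * b" for y b
      using that k0 by (simp add: field_simps power2_eq_square)
    ultimately have "norm (s (k\<^sup>2) t - sin (k * of_real t) / k) \<le> 4 * pi * M / (norm k)\<^sup>2 * exp (\<bar>Im k\<bar> * t)"
      by blast
    with 1 show ?thesis by blast
  qed
  moreover have "2 * pi * M \<ge> 1" using mult_mono[of 1 "2 * pi" 1 M] pi_gt3 M by simp
  ultimately show ?thesis
    using M by (intro exI[of _ "4 * pi * M"] conjI exI[of _ "2 * pi * M"]) auto
qed

text \<open>Absolute values alone stop at O(1/|k|). Hence s is replaced by sin(k u) / k in the
  Duhamel integral: the error of this and the term W d cost only O(|k|^-2), and the explicit part is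
  treated through its oscillation.\<close>

lemma h_asymptotics:
  assumes e: "0 < e"
  shows "\<exists>K\<ge>1. \<forall>k. norm k \<ge> K \<longrightarrow> norm (h (k\<^sup>2) pi) \<le> e / norm k * exp (\<bar>Im k\<bar> * pi)"
proof -
  obtain M where M: "M \<ge> 1" "\<And>u. 0 \<le> u \<Longrightarrow> u \<le> pi \<Longrightarrow> norm (W u) \<le> M"
     "\<And>u. 0 \<le> u \<Longrightarrow> u \<le> pi \<Longrightarrow> norm (W' u) \<le> M"
    using W_bounds by blast
  obtain C K1 where C: "C > 0" "K1 \<ge> 1"
    "\<And>k u. norm k \<ge> K1 \<Longrightarrow> 0 \<le> u \<Longrightarrow> u \<le> pi \<Longrightarrow> norm (d (k\<^sup>2) u) \<le> C / (norm k)\<^sup>2 * exp (\<bar>Im k\<bar> * u)"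
    "\<And>k u. norm k \<ge> K1 \<Longrightarrow> 0 \<le> u \<Longrightarrow> u \<le> pi \<Longrightarrow> norm (s (k\<^sup>2) u - sin (k * of_real u) / k) \<le> C / (norm k)\<^sup>2 * exp (\<bar>Im k\<bar> * u)"
    using d_s_bounds by blast
  obtain K2 where K2: "K2 \<ge> 1" "\<And>k::complex. norm k \<ge> K2 \<Longrightarrow>
      norm (integral {0..pi} (\<lambda>u. sin (k * of_real (pi - 2 * u)) * W' u)) \<le> e * exp (\<bar>Im k\<bar> * pi)"
    using riemann_lebesgue[OF _ e, of W'] contW' continuous_on_subset by blast
  \<comment> \<open>Beyond 4 pi M C / e the O(|k|^-2) remainder takes at most half of the allowed
    bound; the Riemann-Lebesgue term takes the other half.\<close>
  define K where "K = max K1 (max K2 (4 * pi * M * C / e))"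
  have "norm (h (k\<^sup>2) pi) \<le> e / norm k * exp (\<bar>Im k\<bar> * pi)" if K: "norm k \<ge> K" for k
  proof -
    let ?E = "exp (\<bar>Im k\<bar> * pi)"
    have k: "k \<noteq> 0" "norm k > 0" "norm k \<ge> K1" "norm k \<ge> K2" "norm k \<ge> 4 * pi * M * C / e"
      using K C by (auto simp: K_def)
    define R where "R = integral {0..pi} (\<lambda>u. sin (k * of_real (pi - 2 * u)) * W' u)"
    have I1: "((\<lambda>u. cos (k * of_real (pi - u)) * (W u * d (k\<^sup>2) u + W' u * s (k\<^sup>2) u)) has_integral (- h (k\<^sup>2) pi)) {0..pi}"
      using variation_of_constants(2)[OF pi_ge_zero d_derivative h_derivative, of k]
      by (simp add: d_h_0)
    have I2: "((\<lambda>u. sin (k * of_real (pi - 2 * u)) * W' u) has_integral R) {0..pi}"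
      unfolding R_def
      by (intro integrable_integral integrable_continuous_interval continuous_intros continuous_on_subset[OF contW']) auto
    \<comment> \<open>The non-oscillating half of the product carries the factor
      \<open>sin (k * of_real pi)\<close>, which can be as large as the full exponential, so
      smallness cannot help: its integral has to vanish exactly.\<close>
    have I3: "(W' has_integral 0) {0..pi}"
      using has_integral_vector_derivative[OF pi_ge_zero dW] per by simp
    \<comment> \<open>Subtracting the explicit product, split into its two halves, leaves by
      \<open>eq\<close> an integrand made of W d and the error of s.\<close>
    have I: "((\<lambda>u. cos (k * of_real (pi - u)) * (W u * d (k\<^sup>2) u + W' u * s (k\<^sup>2) u)
        + 1 / (2 * k) * (sin (k * of_real (pi - 2 * u)) * W' u) - sin (k * of_real pi) / (2 * k) * W' u)
       has_integral (- h (k\<^sup>2) pi + 1 / (2 * k) * R - sin (k * of_real pi) / (2 * k) * 0)) {0..pi}"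
      by (intro has_integral_diff has_integral_add has_integral_mult_right I1 I2 I3)
    have trig: "sin (k * of_real pi) - sin (k * of_real (pi - 2 * u)) = 2 * (cos (k * of_real (pi - u)) * sin (k * of_real u))" for u
    proof -
      have 1: "k * of_real pi = k * of_real (pi - u) + k * of_real u"
        and 2: "k * of_real (pi - 2 * u) = k * of_real (pi - u) - k * of_real u"
        by (simp_all add: algebra_simps)
      show ?thesis unfolding 1 2 sin_add sin_diff by simp
    qed
    have eq: "cos (k * of_real (pi - u)) * (W u * d (k\<^sup>2) u + W' u * s (k\<^sup>2) u)
        + 1 / (2 * k) * (sin (k * of_real (pi - 2 * u)) * W' u) - sin (k * of_real pi) / (2 * k) * W' u
      = cos (k * of_real (pi - u)) * (W u * d (k\<^sup>2) u + W' u * (s (k\<^sup>2) u - sin (k * of_real u) / k))" for u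
    proof -
      have "1 / (2 * k) * (sin (k * of_real (pi - 2 * u)) * W' u) - sin (k * of_real pi) / (2 * k) * W' u
        = - (W' u / (2 * k)) * (sin (k * of_real pi) - sin (k * of_real (pi - 2 * u)))"
      proof -
        have "1 / (2 * k) * (b * w) - a / (2 * k) * w = - (w / (2 * k)) * (a - b)" for a b w :: complex
          using k by (simp add: field_simps)
        then show ?thesis by blast
      qed
      also have "\<dots> = - (W' u * (cos (k * of_real (pi - u)) * sin (k * of_real u)) / k)"
        unfolding trig using k by (simp add: field_simps)
      finally show ?thesis by (simp add: algebra_simps)
    qed
    have "norm (- h (k\<^sup>2) pi + 1 / (2 * k) * R) \<le> pi * (2 * M * C / (norm k)\<^sup>2) * ?E"
    proof (rule kernel_integral_bound)
      show "((\<lambda>u. cos (k * of_real (pi - u)) * (W u * d (k\<^sup>2) u + W' u * (s (k\<^sup>2) u - sin (k * of_real u) / k)))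
        has_integral (- h (k\<^sup>2) pi + 1 / (2 * k) * R)) {0..pi}"
        using I unfolding eq by simp
      fix u :: real assume u: "0 \<le> u" "u \<le> pi"
      show "norm (cos (k * of_real (pi - u))) \<le> exp (\<bar>Im k\<bar> * (pi - u))"
        using u by (intro norm_trig_le_exp) auto
      have "norm (W u * d (k\<^sup>2) u) \<le> M * (C / (norm k)\<^sup>2 * exp (\<bar>Im k\<bar> * u))"
        "norm (W' u * (s (k\<^sup>2) u - sin (k * of_real u) / k)) \<le> M * (C / (norm k)\<^sup>2 * exp (\<bar>Im k\<bar> * u))"
        unfolding norm_mult
        by (rule mult_mono, use M u in blast, use C u k in blast, use M in simp, simp)+
      from norm_triangle_mono[OF this]
      show "norm (W u * d (k\<^sup>2) u + W' u * (s (k\<^sup>2) u - sin (k * of_real u) / k)) \<le> 2 * M * C / (norm k)\<^sup>2 * exp (\<bar>Im k\<bar> * u)"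
        by (simp add: mult_ac)
    qed (use M C in auto)
    also have "\<dots> \<le> e / (2 * norm k) * ?E"
    proof (intro mult_right_mono)
      have "4 * pi * M * C \<le> e * norm k" using k(5) e by (simp add: field_simps)
      then show "pi * (2 * M * C / (norm k)\<^sup>2) \<le> e / (2 * norm k)"
        using k(2) by (simp add: field_simps power2_eq_square)
    qed auto
    finally have 1: "norm (- h (k\<^sup>2) pi + 1 / (2 * k) * R) \<le> e / (2 * norm k) * ?E" .
    have "norm (1 / (2 * k) * R) = norm R / (2 * norm k)" by (simp add: norm_mult norm_divide)
    also have "\<dots> \<le> e * ?E / (2 * norm k)" using K2(2)[OF k(4)] by (intro divide_right_mono) (auto simp: R_def)
    finally have 2: "norm (1 / (2 * k) * R) \<le> e * ?E / (2 * norm k)" .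
    have "h (k\<^sup>2) pi = 1 / (2 * k) * R - (- h (k\<^sup>2) pi + 1 / (2 * k) * R)" by simp
    then have "norm (h (k\<^sup>2) pi) \<le> e * ?E / (2 * norm k) + e / (2 * norm k) * ?E"
      using norm_triangle_le_diff[OF add_mono[OF 2 1]] by simp
    then show ?thesis using k(2) by (simp add: field_simps)
  qed
  moreover have "K \<ge> 1" using C by (simp add: K_def)
  ultimately show ?thesis by blast
qed

end

subsection \<open>Sums over zeros of entire functions\<close>

text \<open>The assumption \<open>F b \<noteq> 0\<close> is how an entire function is said not to
  vanish identically; its zeros are then isolated.\<close>

lemma entire_eventually_nonzero:
  fixes F :: "complex \<Rightarrow> complex"
  assumes F: "F holomorphic_on UNIV" "F b \<noteq> 0"
  shows "\<forall>\<^sub>F z in at w. F z \<noteq> 0"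
proof (cases "F w = 0")
  case True
  obtain r where "0 < r" "\<And>z. z \<in> ball w r - {w} \<Longrightarrow> F z \<noteq> 0"
    using isolated_zeros[OF F(1) open_UNIV connected_UNIV UNIV_I True UNIV_I F(2)] by metis
  then show ?thesis
    by (auto simp: eventually_at dist_commute intro!: exI[of _ r])
next
  case False
  have "continuous_on UNIV F" using F by (intro holomorphic_on_imp_continuous_on)
  then have "(F \<longlongrightarrow> F w) (at w)" by (simp add: continuous_on_eq_continuous_at isCont_def)
  then show ?thesis using False by (rule tendsto_imp_eventually_ne)
qed

lemma entire_zorder:
  fixes F :: "complex \<Rightarrow> complex"
  assumes F: "F holomorphic_on UNIV" "F b \<noteq> 0"
  shows "F w = 0 \<Longrightarrow> zorder F w > 0" "F w \<noteq> 0 \<Longrightarrow> zorder F w = 0"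
proof -
  have an: "F analytic_on {w}" using F(1) analytic_on_holomorphic by auto
  have fr: "\<exists>\<^sub>F z in at w. F z \<noteq> 0"
    by (intro eventually_frequently entire_eventually_nonzero[OF F]) auto
  show "F w = 0 \<Longrightarrow> zorder F w > 0" "F w \<noteq> 0 \<Longrightarrow> zorder F w = 0"
    using zorder_pos_iff'[OF an fr] zorder_eq_0_iff[OF an fr] by auto
qed

lemma entire_finite_zeros:
  fixes F :: "complex \<Rightarrow> complex"
  assumes F: "F holomorphic_on UNIV" "F b \<noteq> 0"
  shows "finite {w. norm w < R \<and> F w = 0}"
proof (cases "F constant_on UNIV")
  case True
  then have "F w \<noteq> 0" for w using F(2) by (auto simp: constant_on_def)
  then show ?thesis by simp
next
  case False
  have "finite {z \<in> cball 0 R. F z = 0}"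
    by (rule holomorphic_compact_finite_zeros[OF F(1) open_UNIV connected_UNIV _ _ False]) auto
  then show ?thesis by (rule finite_subset[rotated]) auto
qed

text \<open>The sum delivered by the generalised argument principle; weight 1 counts zeros and
  weight z adds them up. Infinitely many zeros in the disc would make the value 0 by the convention
  for infinite index sets.\<close>

definition zero_sum :: "(complex \<Rightarrow> complex) \<Rightarrow> real \<Rightarrow> (complex \<Rightarrow> complex) \<Rightarrow> complex" where
  "zero_sum F R h = (\<Sum>w | norm w < R \<and> F w = 0. of_int (zorder F w) * h w)"

text \<open>Points that are not zeros have order 0, which allows two functions to be summed over one
  index set.\<close>

lemma zero_sum_superset:
  fixes F :: "complex \<Rightarrow> complex"
  assumes F: "F holomorphic_on UNIV" "F b \<noteq> 0"
    and A: "finite A" "{w. norm w < R \<and> F w = 0} \<subseteq> A" "A \<subseteq> {w. norm w < R}"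
  shows "zero_sum F R h = (\<Sum>w\<in>A. of_int (zorder F w) * h w)"
  unfolding zero_sum_def using A entire_zorder(2)[OF F]
  by (intro sum.mono_neutral_left) auto

lemma zero_sum_mult:
  fixes F G :: "complex \<Rightarrow> complex"
  assumes F: "F holomorphic_on UNIV" "F a \<noteq> 0" and G: "G holomorphic_on UNIV" "G b \<noteq> 0"
  shows "zero_sum (\<lambda>z. F z * G z) R h = zero_sum F R h + zero_sum G R h"
proof -
  define A where "A = {w. norm w < R \<and> F w = 0} \<union> {w. norm w < R \<and> G w = 0}"
  have A: "finite A" unfolding A_def using entire_finite_zeros[OF F] entire_finite_zeros[OF G] by simp
  have ev: "\<forall>\<^sub>F z in at w. F z * G z \<noteq> 0" for w
    using entire_eventually_nonzero[OF F] entire_eventually_nonzero[OF G] by eventually_elim simp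
  have an: "F analytic_on {w}" "G analytic_on {w}" for w
    using F(1) G(1) analytic_on_holomorphic by auto
  obtain c where c: "F c * G c \<noteq> 0"
    using eventually_happens'[OF _ ev[of 0]] by auto
  have FG: "(\<lambda>z. F z * G z) holomorphic_on UNIV" by (intro holomorphic_intros F G)
  have "zero_sum (\<lambda>z. F z * G z) R h = (\<Sum>w\<in>A. of_int (zorder (\<lambda>z. F z * G z) w) * h w)"
    by (intro zero_sum_superset[OF FG c] A) (auto simp: A_def)
  also have "\<dots> = (\<Sum>w\<in>A. of_int (zorder F w) * h w + of_int (zorder G w) * h w)"
    by (simp add: zorder_times_analytic[OF an ev] algebra_simps)
  also have "\<dots> = zero_sum F R h + zero_sum G R h"
  proof -
    have "A \<subseteq> {w. norm w < R}" by (auto simp: A_def)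
    then show ?thesis
      using zero_sum_superset[OF F A, of R h] zero_sum_superset[OF G A, of R h]
      by (simp add: A_def sum.distrib)
  qed
  finally show ?thesis .
qed

lemma zero_sum_linear:
  assumes "norm a < R"
  shows "zero_sum (\<lambda>z. z - a) R h = h a"
proof -
  have "zorder (\<lambda>z. z - a) a = 1"
    by (rule simple_zeroI[where S = UNIV and g = "\<lambda>_. 1"]) auto
  moreover have "{w. norm w < R \<and> w - a = 0} = {a}" using assms by auto
  ultimately show ?thesis by (simp add: zero_sum_def)
qed

lemma zero_sum_uminus: "zero_sum (\<lambda>z. - F z) R h = zero_sum F R h"
  by (simp add: zero_sum_def)

lemma argument_principle_circle:
  assumes F: "F holomorphic_on UNIV" and nz: "\<And>z. norm z = R \<Longrightarrow> F z \<noteq> 0" and R: "0 < R"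
    and h: "h holomorphic_on UNIV"
  shows "contour_integral (circlepath 0 R) (\<lambda>z. deriv F z * h z / F z) = 2 * pi * \<i> * zero_sum F R h"
proof -
  have b: "F (of_real R) \<noteq> 0" using nz R by simp
  \<comment> \<open>The larger ball is an open set around the closed disc; zeros in it beyond the
    circle have winding number 0 and drop out.\<close>
  define Z where "Z = {w \<in> ball 0 (R + 1). F w = 0 \<or> w \<in> {}}"
  have Z: "Z = {w. norm w < R + 1 \<and> F w = 0}" by (auto simp: Z_def)
  have fin: "finite Z" unfolding Z by (rule entire_finite_zeros[OF F b])
  have wn0: "winding_number (circlepath 0 R) w = 0" if "norm w > R" for w
    using that R by (intro winding_number_zero_outside[where s = "cball 0 R"]) auto
  have "contour_integral (circlepath 0 R) (\<lambda>z. deriv F z * h z / F z)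
    = 2 * pi * \<i> * (\<Sum>p\<in>Z. winding_number (circlepath 0 R) p * h p * zorder F p)"
    unfolding Z_def
  proof (rule argument_principle)
    show "F holomorphic_on ball 0 (R + 1) - {}" "h holomorphic_on ball 0 (R + 1)"
      using F h by (auto intro: holomorphic_on_subset)
    show "path_image (circlepath 0 R) \<subseteq> ball 0 (R + 1) - {w \<in> ball 0 (R + 1). F w = 0 \<or> w \<in> {}}"
      using R nz by auto
    show "finite {w \<in> ball 0 (R + 1). F w = 0 \<or> w \<in> {}}" using fin by (simp add: Z_def)
    show "\<forall>z. z \<notin> ball 0 (R + 1) \<longrightarrow> winding_number (circlepath 0 R) z = 0"
      using wn0 by auto
  qed auto
  also have "(\<Sum>p\<in>Z. winding_number (circlepath 0 R) p * h p * zorder F p) = zero_sum F R h"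
    unfolding zero_sum_def
  proof (rule sum.mono_neutral_cong_right[OF fin])
    show "\<forall>i\<in>Z - {w. norm w < R \<and> F w = 0}. winding_number (circlepath 0 R) i * h i * zorder F i = 0"
    proof
      fix i assume "i \<in> Z - {w. norm w < R \<and> F w = 0}"
      then have "norm i > R" using nz[of i] by (auto simp: Z not_less le_less)
      then show "winding_number (circlepath 0 R) i * h i * zorder F i = 0" by (simp add: wn0)
    qed
    show "winding_number (circlepath 0 R) w * h w * zorder F w = of_int (zorder F w) * h w"
      if "w \<in> {w. norm w < R \<and> F w = 0}" for w
      using that winding_number_circlepath[of w 0 R] by simp
  qed (auto simp: Z)
  finally show ?thesis .
qed

text \<open>A quantitative form of Rouche's theorem: both differences are contour integrals involving the
  logarithm of the quotient, which is small on the circle.\<close>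
lemma zero_sum_comparison:
  assumes F: "F holomorphic_on UNIV" and G: "G holomorphic_on UNIV" and R: "0 < R" and e: "e < 1/2"
    and G0: "\<And>z. norm z = R \<Longrightarrow> G z \<noteq> 0"
    and q: "\<And>z. norm z = R \<Longrightarrow> norm (F z / G z - 1) \<le> e"
  shows "zero_sum F R (\<lambda>_. 1) = zero_sum G R (\<lambda>_. 1)"
    and "norm (zero_sum F R (\<lambda>z. z) - zero_sum G R (\<lambda>z. z)) \<le> 2 * e * R"
proof -
  have F0: "F z \<noteq> 0" if "norm z = R" for z
    using q[OF that] e by auto
  define H where "H z = Ln (F z / G z)" for z
  let ?C = "circlepath 0 R"
  have dF: "(F has_field_derivative deriv F z) (at z)" and dG: "(G has_field_derivative deriv G z) (at z)" for z
    using F G by (auto intro: holomorphic_derivI)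
  \<comment> \<open>A quotient within 1/2 of 1 has positive real part, so the principal logarithm
    applies on the whole circle without a choice of branch.\<close>
  have slit: "F z / G z \<notin> \<real>\<^sub>\<le>\<^sub>0" if "norm z = R" for z
  proof -
    have "\<bar>Re (F z / G z - 1)\<bar> \<le> e" using abs_Re_le_cmod[of "F z / G z - 1"] q[OF that] by linarith
    then have "Re (F z / G z) > 0" using e by simp
    then show ?thesis by (auto elim!: nonpos_Reals_cases)
  qed
  have dH: "(H has_field_derivative (deriv F z / F z - deriv G z / G z)) (at z)" if z: "norm z = R" for z
    unfolding H_def
    by (rule derivative_eq_intros dF dG refl G0[OF z] slit[OF z])+ 
       (use F0[OF z] G0[OF z] in \<open>simp add: field_simps power2_eq_square\<close>)
  have H_le: "norm (H z) \<le> 2 * e" if z: "norm z = R" for z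
  proof -
    let ?u = "F z / G z - 1"
    have u: "norm ?u \<le> e" "norm ?u < 1/2" using q[OF z] e by auto
    have "norm (Ln (1 + ?u) - ?u) \<le> (norm ?u)\<^sup>2 / (1 - norm ?u)"
      by (rule Ln_approx_linear) (use u in linarith)
    also have "\<dots> \<le> norm ?u"
    proof -
      have "norm ?u * norm ?u \<le> norm ?u * (1 - norm ?u)" using u by (intro mult_left_mono) auto
      then show ?thesis using u by (simp add: power2_eq_square divide_le_eq)
    qed
    finally have "norm (Ln (1 + ?u)) \<le> 2 * norm ?u"
      using norm_triangle_sub[of "Ln (1 + ?u)" ?u] by linarith
    then show ?thesis using u by (simp add: H_def)
  qed
  have img: "path_image ?C = {z. norm z = R}" using R by auto
  have nR: "norm z = R" if "z \<in> path_image ?C" for z using that img by blast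
  have I: "(\<lambda>z. deriv f z * h z / f z) contour_integrable_on ?C"
    if "f holomorphic_on UNIV" "\<And>z. norm z = R \<Longrightarrow> f z \<noteq> 0" "h holomorphic_on UNIV" for f h
  proof (rule contour_integrable_continuous_circlepath)
    show "continuous_on (path_image ?C) (\<lambda>z. deriv f z * h z / f z)"
      using that nR holomorphic_deriv[OF that(1)]
      by (intro continuous_intros holomorphic_on_imp_continuous_on) (auto intro: holomorphic_on_subset)
  qed
  have log: "contour_integral ?C (\<lambda>z. h z * (deriv F z / F z - deriv G z / G z))
     = 2 * pi * \<i> * (zero_sum F R h - zero_sum G R h)" if h: "h holomorphic_on UNIV" for h
  proof -
    have "contour_integral ?C (\<lambda>z. h z * (deriv F z / F z - deriv G z / G z))
       = contour_integral ?C (\<lambda>z. deriv F z * h z / F z - deriv G z * h z / G z)"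
      by (simp add: algebra_simps)
    also have "\<dots> = contour_integral ?C (\<lambda>z. deriv F z * h z / F z) - contour_integral ?C (\<lambda>z. deriv G z * h z / G z)"
      by (intro contour_integral_diff I F G h F0 G0)
    finally show ?thesis
      using argument_principle_circle[OF F F0 R h] argument_principle_circle[OF G G0 R h]
      by (simp add: right_diff_distrib)
  qed
  \<comment> \<open>On the circle \<open>H\<close> is a primitive of the difference of the
    logarithmic derivatives, which forces equal numbers of zeros.\<close>
  have "((\<lambda>z. deriv F z / F z - deriv G z / G z) has_contour_integral 0) ?C"
    by (rule Cauchy_theorem_primitive[where S = "path_image ?C" and f = H])
       (auto intro!: has_field_derivative_at_within dH nR simp del: path_image_circlepath)
  then have "contour_integral ?C (\<lambda>z. 1 * (deriv F z / F z - deriv G z / G z)) = 0"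
    by (simp add: contour_integral_unique)
  then show "zero_sum F R (\<lambda>_. 1) = zero_sum G R (\<lambda>_. 1)"
    using log[of "\<lambda>_. 1"] by simp
  have contH: "continuous_on (path_image ?C) H"
    using dH nR by (intro continuous_at_imp_continuous_on ballI) (blast intro: DERIV_isCont)
  then have HI: "(H has_contour_integral contour_integral ?C H) ?C"
    by (intro has_contour_integral_integral contour_integrable_continuous_circlepath)
  \<comment> \<open>Integration by parts with the primitive z H(z): the integral of z H' is minus
    that of H, hence bounded by 2 e times the length 2 pi R.\<close>
  have "((\<lambda>z. z * (deriv F z / F z - deriv G z / G z) + H z) has_contour_integral 0) ?C"
  proof (rule Cauchy_theorem_primitive[where S = "path_image ?C" and f = "\<lambda>z. z * H z"])
    fix z assume "z \<in> path_image ?C"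
    from dH[OF nR[OF this]]
    have "((\<lambda>z. z * H z) has_field_derivative z * (deriv F z / F z - deriv G z / G z) + 1 * H z) (at z)"
      by (intro DERIV_mult' DERIV_ident)
    then show "((\<lambda>z. z * H z) has_field_derivative z * (deriv F z / F z - deriv G z / G z) + H z) (at z within path_image ?C)"
      by (auto intro: has_field_derivative_at_within)
  qed auto
  from has_contour_integral_diff[OF this HI]
  have "contour_integral ?C (\<lambda>z. z * (deriv F z / F z - deriv G z / G z)) = - contour_integral ?C H"
    by (auto intro!: contour_integral_unique)
  then have "2 * pi * \<i> * (zero_sum F R (\<lambda>z. z) - zero_sum G R (\<lambda>z. z)) = - contour_integral ?C H"
    using log[of "\<lambda>z. z"] by simp
  then have "norm (2 * pi * \<i> * (zero_sum F R (\<lambda>z. z) - zero_sum G R (\<lambda>z. z))) = norm (contour_integral ?C H)"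
    by simp
  then have "2 * pi * norm (zero_sum F R (\<lambda>z. z) - zero_sum G R (\<lambda>z. z)) = norm (contour_integral ?C H)"
    by (simp add: norm_mult)
  also have "\<dots> \<le> 2 * e * (2 * pi * R)"
    using H_le q[of "of_real R"] R order_trans[OF norm_ge_zero]
    by (intro has_contour_integral_bound_circlepath[OF HI]) auto
  finally have "2 * pi * norm (zero_sum F R (\<lambda>z. z) - zero_sum G R (\<lambda>z. z)) \<le> 2 * pi * (2 * e * R)"
    by (simp add: mult_ac)
  then show "norm (zero_sum F R (\<lambda>z. z) - zero_sum G R (\<lambda>z. z)) \<le> 2 * e * R"
    by (simp add: mult_ac)
qed

text \<open>Non-decreasing moduli make the indices with \<open>norm (z m) < R\<close> an initial
  segment, of length the number n of zeros in the disc. The order among equal moduli is immaterial,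
  as this condition sees the modulus alone.\<close>

lemma zeros_enum_partial_sum:
  fixes F :: "complex \<Rightarrow> complex"
  assumes z: "zeros_enum F z" and F: "F holomorphic_on UNIV" "F b \<noteq> 0"
    and unb: "\<And>r. \<exists>w. norm w > r \<and> F w = 0"
    and n: "zero_sum F R (\<lambda>_. 1) = of_nat n"
  shows "(\<Sum>m<n. z m) = zero_sum F R (\<lambda>z. z)"
proof -
  have mono: "norm (z i) \<le> norm (z j)" if "i \<le> j" for i j
    using z that unfolding zeros_enum_def mono_def by blast
  have card: "card {m. z m = w} = (if F w = 0 then nat (zorder F w) else 0)" for w
    using z unfolding zeros_enum_def by blast
  text \<open>\<open>zeros_enum\<close> only prescribes cardinalities, and infinite fibres have cardinality 0.\<close>
  have fin: "finite {m. z m = w}" for w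
  proof (rule ccontr)
    assume inf: "infinite {m. z m = w}"
    \<comment> \<open>A zero of larger modulus has some index i; an infinite fibre over w would
      contain an index after i, against monotonicity.\<close>
    obtain v where v: "norm v > norm w" "F v = 0" using unb by blast
    have "card {m. z m = v} > 0" using card[of v] entire_zorder(1)[OF F v(2)] v by simp
    then obtain i where i: "z i = v" by (metis (mono_tags) card_gt_0_iff mem_Collect_eq ex_in_conv)
    obtain j where "j \<ge> i" "z j = w" using inf by (metis (mono_tags) infinite_nat_iff_unbounded_le mem_Collect_eq)
    then show False using mono[of i j] i v by simp
  qed
  have zero: "F (z m) = 0" for m
  proof (rule ccontr)
    assume "F (z m) \<noteq> 0"
    then have "card {i. z i = z m} = 0" using card by simp
    then show False using fin[of "z m"] by auto
  qed
  define Z where "Z = {w. norm w < R \<and> F w = 0}"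
  have Z: "finite Z" unfolding Z_def by (rule entire_finite_zeros[OF F])
  define M where "M = {m. norm (z m) < R}"
  have M: "M = (\<Union>w\<in>Z. {m. z m = w})" using zero by (auto simp: M_def Z_def)
  have finM: "finite M" unfolding M using Z fin by auto
  have ord: "complex_of_nat (card {m. z m = w}) = of_int (zorder F w)" if "w \<in> Z" for w
    using that card[of w] entire_zorder(1)[OF F, of w] by (simp add: Z_def)
  have sumM: "(\<Sum>m\<in>M. g (z m)) = zero_sum F R g" for g :: "complex \<Rightarrow> complex"
  proof -
    have "(\<Sum>m\<in>M. g (z m)) = (\<Sum>w\<in>Z. \<Sum>m | z m = w. g (z m))"
      unfolding M by (rule sum.UNION_disjoint) (use Z fin in auto)
    also have "\<dots> = (\<Sum>w\<in>Z. of_nat (card {m. z m = w}) * g w)" by (intro sum.cong) auto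
    also have "\<dots> = (\<Sum>w\<in>Z. of_int (zorder F w) * g w)" by (intro sum.cong) (auto simp: ord)
    finally show ?thesis by (simp add: zero_sum_def Z_def)
  qed
  have "complex_of_nat (card M) = of_nat n" using sumM[of "\<lambda>_. 1"] n by simp
  then have cM: "card M = n" by simp
  have "M \<subseteq> {..<n}"
  proof
    fix m assume m: "m \<in> M"
    have "{..m} \<subseteq> M" using mono m by (fastforce simp: M_def intro: order_le_less_trans)
    then have "card {..m} \<le> card M" using finM by (intro card_mono)
    then show "m \<in> {..<n}" by (simp add: cM)
  qed
  then have "M = {..<n}" using cM by (intro card_subset_eq) auto
  then show ?thesis using sumM[of "\<lambda>z. z"] by simp
qed

text \<open>If the zeros were bounded, the counts on all large discs would agree, whereas a changes
  at every step. This supplies the assumption \<open>unb\<close> of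
  \<open>zeros_enum_partial_sum\<close>.\<close>

lemma unbounded_zeros:
  fixes F :: "complex \<Rightarrow> complex"
  assumes "\<And>n. n \<ge> n0 \<Longrightarrow> zero_sum F ((real n + 1/2)\<^sup>2) (\<lambda>_. 1) = of_nat (a n)"
    and "\<And>n. a (Suc n) \<noteq> a n"
  shows "\<exists>w. norm w > r \<and> F w = 0"
proof (rule ccontr)
  assume "\<not> (\<exists>w. norm w > r \<and> F w = 0)"
  then have r: "F w = 0 \<Longrightarrow> norm w \<le> r" for w by force
  define n where "n = max n0 (nat \<lceil>\<bar>r\<bar>\<rceil> + 1)"
  have nr: "r < real n" by (simp add: n_def) linarith
  have "real n \<le> (real m + 1/2)\<^sup>2" if "m \<ge> n" for m
  proof -
    have "real n \<le> real m" "real m * 1 \<le> real m * real m"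
      using that by (auto intro!: mult_left_mono simp: n_def)
    then show ?thesis by (simp add: power2_eq_square algebra_simps)
  qed
  then have "{w. norm w < (real m + 1/2)\<^sup>2 \<and> F w = 0} = {w. F w = 0}" if "m \<ge> n" for m
    using r nr that by fastforce
  then have "zero_sum F ((real (Suc n) + 1/2)\<^sup>2) (\<lambda>_. 1) = zero_sum F ((real n + 1/2)\<^sup>2) (\<lambda>_. 1)"
    unfolding zero_sum_def by (simp only: le_refl le_SucI)
  then show False using assms(1)[of n] assms(1)[of "Suc n"] assms(2)[of n] by (simp add: n_def)
qed

subsection \<open>The free operator\<close>

lemma free_solution:
  assumes "fundamental_system (\<lambda>_. 0) c c1 s s1"
  shows "c (k\<^sup>2) t = cos (k * of_real t)" "c1 (k\<^sup>2) t = - k * sin (k * of_real t)"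
proof -
  interpret fundamental_system "\<lambda>_. 0" c c1 s s1 by fact
  have S: "((\<lambda>u. sin (k * of_real u)) has_vector_derivative k * cos (k * of_real t)) (at t)"
    and C: "((\<lambda>u. cos (k * of_real u)) has_vector_derivative - (k * sin (k * of_real t))) (at t)" for t
    using trig_kernel_derivative[of k 0 1 t] by simp_all
  have "c (k\<^sup>2) t - cos (k * of_real t) = 0 \<and> c1 (k\<^sup>2) t - (- k * sin (k * of_real t)) = 0"
  proof (rule linear_ode_unique[where q = "\<lambda>_. - k\<^sup>2"])
    show "((\<lambda>t. c (k\<^sup>2) t - cos (k * of_real t)) has_vector_derivative c1 (k\<^sup>2) t - (- k * sin (k * of_real t))) (at t)" for t
      using has_vector_derivative_diff[OF c C] by simp
    show "((\<lambda>t. c1 (k\<^sup>2) t - (- k * sin (k * of_real t))) has_vector_derivative - k\<^sup>2 * (c (k\<^sup>2) t - cos (k * of_real t))) (at t)" for t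
      using has_vector_derivative_diff[OF c1 has_vector_derivative_mult_right[OF S, of "- k"], of "k\<^sup>2" t]
      by (simp add: algebra_simps power2_eq_square)
  qed (simp_all add: c0)
  then show "c (k\<^sup>2) t = cos (k * of_real t)" "c1 (k\<^sup>2) t = - k * sin (k * of_real t)"
    by (simp_all add: eq_neg_iff_add_eq_0)
qed

text \<open>As a function of k^2, -k sin(k pi) vanishes exactly at m^2 for natural m. The zero at 0
  is simple too: both factors vanish there to first order in k, which is first order in k^2.\<close>

lemma free_neumann_zero_count:
  assumes fs: "fundamental_system (\<lambda>_. 0) c c1 s s1"
  shows "zero_sum (\<lambda>l. c1 l pi) ((real n + 1/2)\<^sup>2) (\<lambda>_. 1) = of_nat (Suc n)"
proof -
  interpret fundamental_system "\<lambda>_. 0" c c1 s s1 by fact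
  define F where "F l = c1 l pi" for l
  have zeros: "F l = 0 \<longleftrightarrow> (\<exists>m::nat. l = (of_nat m)\<^sup>2)" for l
  proof -
    define k where "k = csqrt l"
    have l: "l = k\<^sup>2" by (simp add: k_def)
    have "F l = 0 \<longleftrightarrow> k = 0 \<or> sin (k * of_real pi) = 0"
      by (simp add: F_def l free_solution(2)[OF fs])
    also have "\<dots> \<longleftrightarrow> (\<exists>m::int. k = of_int m)"
    proof -
      have "k * of_real pi = of_real (of_int m * pi) \<longleftrightarrow> k = of_int m" for m
        by simp
      moreover have "k = 0 \<Longrightarrow> k = of_int 0" by simp
      ultimately show ?thesis unfolding sin_eq_0 by blast
    qed
    also have "\<dots> \<longleftrightarrow> (\<exists>m::nat. l = (of_nat m)\<^sup>2)"
    proof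
      assume "\<exists>m::int. k = of_int m"
      then obtain m :: int where "k = of_int m" by blast
      then have "l = (of_nat (nat \<bar>m\<bar>))\<^sup>2" unfolding l by (cases "m \<ge> 0") auto
      then show "\<exists>m::nat. l = (of_nat m)\<^sup>2" by blast
    next
      assume "\<exists>m::nat. l = (of_nat m)\<^sup>2"
      then obtain m :: nat where "k\<^sup>2 = (of_nat m)\<^sup>2" unfolding l by blast
      then have "k = of_int (int m) \<or> k = of_int (- int m)" by (simp add: power2_eq_iff)
      then show "\<exists>m::int. k = of_int m" by blast
    qed
    finally show ?thesis .
  qed
  have simple: "zorder F ((of_nat m)\<^sup>2) = 1" for m :: nat
  proof -
    let ?l = "(of_nat m)\<^sup>2 :: complex"
    have F0: "c1 ?l pi = 0" using zeros[of ?l] by (auto simp: F_def)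
    define J where "J = integral {0..pi} (\<lambda>u. (cos (real m * u))\<^sup>2)"
    have "J \<noteq> 0"
    proof
      assume "J = 0"
      moreover have "continuous_on {0..pi} (\<lambda>u. (cos (real m * u))\<^sup>2)" by (intro continuous_intros)
      ultimately have "(cos (real m * 0))\<^sup>2 = 0"
        using integral_eq_0_iff[of 0 pi "\<lambda>u. (cos (real m * u))\<^sup>2"] unfolding J_def by fastforce
      then show False by simp
    qed
    have "((\<lambda>u. (cos (real m * u))\<^sup>2) has_integral J) {0..pi}"
      unfolding J_def by (intro integrable_integral integrable_continuous_interval continuous_intros)
    from integral_unique[OF has_integral_of_real[OF this, where 'b = complex]]
    have "integral {0..pi} (\<lambda>u. c ?l u * c ?l u) = of_real J"
    proof -
      have "c ?l u * c ?l u = of_real ((cos (real m * u))\<^sup>2)" for u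
      proof -
        have "c ?l u = of_real (cos (real m * u))"
          unfolding free_solution(1)[OF fs] cos_of_real[symmetric] by simp
        then show ?thesis by (simp only: power2_eq_square of_real_mult)
      qed
      then show ?thesis
        using \<open>integral {0..pi} (\<lambda>u. of_real ((cos (real m * u))\<^sup>2)) = complex_of_real J\<close> by simp
    qed
    \<comment> \<open>Since c1 vanishes at this point, only the term with s1 and the integral of c^2
      survives; s1 is nonzero by the Wronskian, and the integrand is nonnegative with value 1 at
      0.\<close>
    then have der: "(F has_field_derivative - s1 ?l pi * of_real J) (at ?l)"
      using sol_has_field_derivative(2)[OF c c1 c0 pi_ge_zero, of ?l] F0 by (simp add: F_def[abs_def])
    have "s1 ?l pi \<noteq> 0" using wronskian_cs[of ?l pi] F0 by auto
    with \<open>J \<noteq> 0\<close> der have "deriv F ?l \<noteq> 0" by (simp add: DERIV_imp_deriv)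
    then show ?thesis
      using F0 holomorphic(2)[OF pi_ge_zero, of UNIV]
      by (intro zorder_zero_eqI[where S = UNIV]) (auto simp: F_def[abs_def])
  qed
  have "{w. norm w < (real n + 1/2)\<^sup>2 \<and> F w = 0} = (\<lambda>m. (of_nat m)\<^sup>2) ` {..n}"
  proof -
    have "norm ((of_nat m)\<^sup>2 :: complex) < (real n + 1/2)\<^sup>2 \<longleftrightarrow> m \<le> n" for m
    proof -
      have "norm ((of_nat m)\<^sup>2 :: complex) < (real n + 1/2)\<^sup>2 \<longleftrightarrow> (real m)\<^sup>2 < (real n + 1/2)\<^sup>2"
        by (simp add: norm_power)
      also have "\<dots> \<longleftrightarrow> real m < real n + 1/2"
        using power_mono_iff[of "real n + 1/2" "real m" 2] by (simp flip: not_le)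
      also have "\<dots> \<longleftrightarrow> m \<le> n" by linarith
      finally show ?thesis .
    qed
    then show ?thesis unfolding zeros by (intro equalityI subsetI) auto
  qed
  moreover have "inj_on (\<lambda>m. (of_nat m)\<^sup>2 :: complex) {..n}"
  proof (rule inj_onI)
    fix i j assume "(of_nat i)\<^sup>2 = ((of_nat j)\<^sup>2 :: complex)"
    then have "of_nat (i\<^sup>2) = (of_nat (j\<^sup>2) :: complex)" by simp
    then show "i = j" unfolding of_nat_eq_iff by simp
  qed
  ultimately have "zero_sum F ((real n + 1/2)\<^sup>2) (\<lambda>_. 1) = of_nat (Suc n)"
    unfolding zero_sum_def by (simp add: sum.reindex simple)
  then show ?thesis by (simp add: F_def[abs_def])
qed

subsection \<open>The trace formula\<close>

lemma fundamental_system_csol_ssol: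
  assumes V: "continuous_on UNIV V"
  shows "fundamental_system (\<lambda>t. V (t + x))
    (\<lambda>l t. csol V l x (t + x)) (\<lambda>l t. vector_derivative (csol V l x) (at (t + x)))
    (\<lambda>l t. ssol V l x (t + x)) (\<lambda>l t. vector_derivative (ssol V l x) (at (t + x)))"
proof
  show "continuous_on UNIV (\<lambda>t. V (t + x))"
    by (intro continuous_on_compose2[OF V] continuous_intros) auto
  have 1: "((\<lambda>t. f (t + x)) has_vector_derivative vector_derivative f (at (t + x))) (at t)"
    and 2: "((\<lambda>t. vector_derivative f (at (t + x))) has_vector_derivative (V (t + x) - l) * f (t + x)) (at t)"
    if "is_sol V l f" for f l t
    using has_vector_derivative_shift[OF is_solD(1)[OF that, of "t + x"]]
      has_vector_derivative_shift[where f = "\<lambda>u. vector_derivative f (at u)", OF is_solD(2)[OF that, of "t + x"]]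
    by simp_all
  note c = csol[OF V, of _ x] and s = ssol[OF V, of _ x]
  show "((\<lambda>t. csol V l x (t + x)) has_vector_derivative vector_derivative (csol V l x) (at (t + x))) (at t)"
    "((\<lambda>t. vector_derivative (csol V l x) (at (t + x))) has_vector_derivative (V (t + x) - l) * csol V l x (t + x)) (at t)"
    "((\<lambda>t. ssol V l x (t + x)) has_vector_derivative vector_derivative (ssol V l x) (at (t + x))) (at t)"
    "((\<lambda>t. vector_derivative (ssol V l x) (at (t + x))) has_vector_derivative (V (t + x) - l) * ssol V l x (t + x)) (at t)" for l t
    using 1[OF c(1)] 2[OF c(1)] 1[OF s(1)] 2[OF s(1)] by simp_all
qed (use csol(2,3)[OF V] ssol(2,3)[OF V] in simp_all)

context hill_system
begin

definition N :: "complex \<Rightarrow> complex" where "N l = c1 l pi"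
text \<open>Formed at the translated base point; \<open>discr_base_point\<close> identifies it with
  the squared discriminant minus 1.\<close>

definition D :: "complex \<Rightarrow> complex" where "D l = ((c l pi + s1 l pi) / 2)\<^sup>2 - 1"

lemma holomorphic_N_D: "N holomorphic_on UNIV" "D holomorphic_on UNIV"
  unfolding N_def[abs_def] D_def[abs_def] by (intro holomorphic_intros holomorphic pi_ge_zero; simp)+

lemma D_eq: "4 * D l = (d l pi)\<^sup>2 + 4 * N l * s l pi"
proof -
  have "4 * D l = (c l pi + s1 l pi)\<^sup>2 - 4 * (c l pi * s1 l pi - c1 l pi * s l pi)"
    unfolding wronskian_cs by (simp add: D_def power_divide field_simps)
  then show ?thesis by (simp add: d_def N_def power2_eq_square algebra_simps)
qed

text \<open>Because \<open>W pi = W 0\<close>, the definition of h at pi reads (l - W 0) s = h - N,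
  which removes s from \<open>D_eq\<close>. The leading part of (l - W 0) D is then -N^2, whence the
  sign of the denominator.\<close>

lemma comparison_eq:
  assumes "N l \<noteq> 0"
  shows "(l - W 0) * D l / (- (N l * N l)) - 1 = - ((l - W 0) * (d l pi)\<^sup>2 / (4 * (N l)\<^sup>2)) - h l pi / N l"
proof -
  have h: "h l pi = N l + (l - W 0) * s l pi" by (simp add: h_def N_def per)
  have "(l - W 0) * (4 * D l) = (l - W 0) * (d l pi)\<^sup>2 + 4 * N l * (h l pi - N l)"
    unfolding D_eq h by (simp add: algebra_simps)
  moreover have "(l - W 0) * D l = (l - W 0) * (4 * D l) / 4" by simp
  ultimately have "(l - W 0) * D l = ((l - W 0) * (d l pi)\<^sup>2 + 4 * N l * (h l pi - N l)) / 4"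
    by (simp only:)
  then show ?thesis using assms by (simp only:) (simp add: field_simps power2_eq_square)
qed

text \<open>This serves two ends: the lower bound for N in the trace estimate, and closeness to the
  free Neumann function for counting zeros.\<close>

lemma comparison_with_free:
  "\<exists>n0. \<forall>n\<ge>n0. \<forall>k. norm k = real n + 1/2 \<longrightarrow>
     norm k * exp (\<bar>Im k\<bar> * pi) / 16 \<le> norm (N (k\<^sup>2)) \<and>
     norm (N (k\<^sup>2) / (- k * sin (k * of_real pi)) - 1) \<le> 1/4 \<and> k * sin (k * of_real pi) \<noteq> 0"
proof -
  obtain C K where C: "C > 0" "K \<ge> 1"
    "\<And>k. norm k \<ge> K \<Longrightarrow> norm (N (k\<^sup>2) + k * sin (k * of_real pi)) \<le> C * exp (\<bar>Im k\<bar> * pi)"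
    using c1_asymptotics unfolding N_def by blast
  \<comment> \<open>Beyond 32 C the error is at most a quarter of the lower bound |k| exp(|Im k| pi)
    / 8 for the main term; this leaves at least 1/16 for N and gives 1/4 for the quotient.\<close>
  define n0 where "n0 = nat \<lceil>max K (32 * C)\<rceil>"
  have "norm k * exp (\<bar>Im k\<bar> * pi) / 16 \<le> norm (N (k\<^sup>2)) \<and>
     norm (N (k\<^sup>2) / (- k * sin (k * of_real pi)) - 1) \<le> 1/4 \<and> k * sin (k * of_real pi) \<noteq> 0"
    if n: "n \<ge> n0" and k: "norm k = real n + 1/2" for n k
  proof -
    let ?E = "exp (\<bar>Im k\<bar> * pi)" and ?S = "k * sin (k * of_real pi)"
    have nk: "norm k \<ge> K" "norm k \<ge> 32 * C" "norm k > 0" using n k C(2) unfolding n0_def by linarith+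
    have S: "norm ?S \<ge> norm k * ?E / 8"
      using mult_left_mono[OF sin_lower_bound_on_circle[OF k], of "norm k"] by (simp add: norm_mult)
    have "0 < norm k * ?E / 8" using nk by simp
    with S have S0: "?S \<noteq> 0" by (metis less_le_trans norm_zero not_less_iff_gr_or_eq)
    have b: "norm (N (k\<^sup>2) + ?S) \<le> C * ?E" by (rule C(3)[OF nk(1)])
    have CE: "32 * (C * ?E) \<le> norm k * ?E" using mult_right_mono[OF nk(2), of ?E] by simp
    have 1: "norm k * ?E / 16 \<le> norm (N (k\<^sup>2))"
    proof -
      have "norm ?S \<le> norm (N (k\<^sup>2) + ?S) + norm (N (k\<^sup>2))"
        using norm_triangle_ineq4[of "N (k\<^sup>2) + ?S" "N (k\<^sup>2)"] by simp
      then show ?thesis using b CE S \<open>0 < norm k * ?E / 8\<close> by linarith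
    qed
    have "N (k\<^sup>2) / (- k * sin (k * of_real pi)) - 1 = - ((N (k\<^sup>2) + ?S) / ?S)"
      using S0 by (simp add: field_simps)
    also have "norm \<dots> \<le> 1/4"
    proof -
      have "norm (N (k\<^sup>2) + ?S) \<le> norm ?S / 4" using b CE S by linarith
      then show ?thesis using S0 by (simp add: norm_divide divide_le_eq del: mult_eq_0_iff)
    qed
    finally show ?thesis using 1 S0 by blast
  qed
  then show ?thesis by blast
qed

text \<open>With l = k^2 and the common exponential cancelled, N is at least |k| / 16, d is
  O(|k|^-2) and h is o(1/|k|). The term with d^2 is therefore O(|k|^-4), and h / N is o(|k|^-2),
  that is o(1/|l|).\<close>

lemma comparison_of_zeros:
  assumes e: "0 < e"
  shows "\<exists>n0. \<forall>n\<ge>n0. \<forall>l. norm l = (real n + 1/2)\<^sup>2 \<longrightarrow> N l \<noteq> 0 \<and>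
     norm ((l - W 0) * D l / (- (N l * N l)) - 1) \<le> e / norm l"
proof -
  obtain n1 where n1: "\<And>n k. n \<ge> n1 \<Longrightarrow> norm k = real n + 1/2 \<Longrightarrow>
     norm k * exp (\<bar>Im k\<bar> * pi) / 16 \<le> norm (N (k\<^sup>2))"
    using comparison_with_free by blast
  obtain C K1 where C: "C > 0" "K1 \<ge> 1"
    "\<And>k u. norm k \<ge> K1 \<Longrightarrow> 0 \<le> u \<Longrightarrow> u \<le> pi \<Longrightarrow> norm (d (k\<^sup>2) u) \<le> C / (norm k)\<^sup>2 * exp (\<bar>Im k\<bar> * u)"
    using d_s_bounds by blast
  \<comment> \<open>Divided by the constant 1/16 in the lower bound for N, e / 32 becomes e /
    2.\<close>
  obtain K2 where K2: "K2 \<ge> 1"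
    "\<And>k. norm k \<ge> K2 \<Longrightarrow> norm (h (k\<^sup>2) pi) \<le> e / 32 / norm k * exp (\<bar>Im k\<bar> * pi)"
    using h_asymptotics[of "e / 32"] e by auto
  \<comment> \<open>After the thresholds for N, d and h, the entry 1 + |W 0| makes |l - W 0| at most
    2 |k|^2, and 256 C^2 / e brings 128 C^2 / |k|^4 below e / (2 |k|^2).\<close>
  define n0 where "n0 = max n1 (nat \<lceil>max K1 (max K2 (max (1 + norm (W 0)) (256 * C\<^sup>2 / e)))\<rceil>)"
  have "N l \<noteq> 0 \<and> norm ((l - W 0) * D l / (- (N l * N l)) - 1) \<le> e / norm l"
    if n: "n \<ge> n0" and l: "norm l = (real n + 1/2)\<^sup>2" for n l
  proof -
    define k where "k = csqrt l"
    have kl: "l = k\<^sup>2" by (simp add: k_def)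
    have "(norm k)\<^sup>2 = (real n + 1/2)\<^sup>2" using l by (simp add: kl norm_power)
    then have k: "norm k = real n + 1/2" by (simp add: power2_eq_iff_nonneg)
    let ?E = "exp (\<bar>Im k\<bar> * pi)" and ?r = "norm k"
    have nk: "n \<ge> n1" "?r \<ge> K1" "?r \<ge> K2" "?r \<ge> 1 + norm (W 0)" "?r \<ge> 256 * C\<^sup>2 / e"
      using n unfolding n0_def k by linarith+
    have r1: "?r \<ge> 1" using nk(4) norm_ge_zero[of "W 0"] by linarith
    have r2: "?r \<le> ?r\<^sup>2" using mult_left_mono[OF r1, of ?r] r1 by (simp add: power2_eq_square)
    have Nb: "?r * ?E / 16 \<le> norm (N l)" unfolding kl by (rule n1[OF nk(1) k])
    have "0 < ?r" using r1 by linarith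
    then have pos: "0 < ?r * ?E / 16" by (simp del: zero_less_norm_iff)
    with Nb have N0: "N l \<noteq> 0" by (metis less_le_trans norm_zero not_less_iff_gr_or_eq)
    have hb: "norm (h l pi) \<le> e / 32 / ?r * ?E" unfolding kl by (rule K2(2)[OF nk(3)])
    have db: "norm (d l pi) \<le> C / ?r\<^sup>2 * ?E" unfolding kl using C(3)[OF nk(2), of pi] by simp
    have lW: "norm (l - W 0) \<le> 2 * ?r\<^sup>2"
      using norm_triangle_ineq4[of l "W 0"] nk(4) r2 by (simp add: kl norm_power)
    have A: "norm (h l pi / N l) \<le> e / 2 / ?r\<^sup>2"
    proof -
      have "norm (h l pi / N l) \<le> (e / 32 / ?r * ?E) / (?r * ?E / 16)"
        unfolding norm_divide using hb Nb pos e by (intro frac_le) auto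
      also have "\<dots> = e / 2 / ?r\<^sup>2" using r1 by (simp add: field_simps power2_eq_square)
      finally show ?thesis .
    qed
    have "norm ((l - W 0) * (d l pi)\<^sup>2 / (4 * (N l)\<^sup>2)) \<le> (2 * ?r\<^sup>2 * (C / ?r\<^sup>2 * ?E)\<^sup>2) / (4 * (?r * ?E / 16)\<^sup>2)"
      unfolding norm_divide norm_mult norm_power norm_numeral using pos
      by (intro frac_le mult_mono power_mono lW db Nb mult_nonneg_nonneg) auto
    also have "\<dots> = 128 * C\<^sup>2 / (?r\<^sup>2 * ?r\<^sup>2)"
      using r1 by (simp add: field_simps power2_eq_square)
    also have "\<dots> \<le> (e / 2 * ?r\<^sup>2) / (?r\<^sup>2 * ?r\<^sup>2)"
    proof (rule divide_right_mono)
      have "256 * C\<^sup>2 \<le> e * ?r" using nk(5) e by (simp add: field_simps)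
      also have "\<dots> \<le> e * ?r\<^sup>2" using r2 e by (intro mult_left_mono) auto
      finally show "128 * C\<^sup>2 \<le> e / 2 * ?r\<^sup>2" by simp
    qed auto
    also have "\<dots> = e / 2 / ?r\<^sup>2"
    proof -
      have "?r\<^sup>2 \<noteq> 0" using r1 by auto
      moreover have "e / 2 * y / (y * y) = e / 2 / y" if "y \<noteq> 0" for y :: real
        using that by simp
      ultimately show ?thesis by blast
    qed
    finally have B: "norm ((l - W 0) * (d l pi)\<^sup>2 / (4 * (N l)\<^sup>2)) \<le> e / 2 / ?r\<^sup>2" .
    have "norm ((l - W 0) * D l / (- (N l * N l)) - 1) \<le> e / 2 / ?r\<^sup>2 + e / 2 / ?r\<^sup>2"
      unfolding comparison_eq[OF N0]
      by (intro norm_triangle_le_diff add_mono A) (use B in \<open>simp only: norm_minus_cancel\<close>)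
    also have "\<dots> = e / norm l" by (simp add: kl norm_power field_simps)
    finally show ?thesis using N0 by blast
  qed
  then show ?thesis by blast
qed

lemma neumann_zero_count:
  "\<exists>n0. \<forall>n\<ge>n0. zero_sum N ((real n + 1/2)\<^sup>2) (\<lambda>_. 1) = of_nat (Suc n)"
proof -
  obtain n0 where n0: "\<And>n k. n \<ge> n0 \<Longrightarrow> norm k = real n + 1/2 \<Longrightarrow>
     norm (N (k\<^sup>2) / (- k * sin (k * of_real pi)) - 1) \<le> 1/4 \<and> k * sin (k * of_real pi) \<noteq> 0"
    using comparison_with_free by blast
  obtain u u1 v v1 where fs: "fundamental_system (\<lambda>_. 0) u u1 v v1"
    by (rule that[OF fundamental_system_csol_ssol[of "\<lambda>_. 0" 0]]) auto
  interpret free: fundamental_system "\<lambda>_. 0" u u1 v v1 by fact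
  have "zero_sum N ((real n + 1/2)\<^sup>2) (\<lambda>_. 1) = of_nat (Suc n)" if n: "n \<ge> n0" for n
  proof -
    have *: "norm (N l / u1 l pi - 1) \<le> 1/4 \<and> u1 l pi \<noteq> 0" if l: "norm l = (real n + 1/2)\<^sup>2" for l
    proof -
      define k where "k = csqrt l"
      have kl: "l = k\<^sup>2" by (simp add: k_def)
      have "(norm k)\<^sup>2 = (real n + 1/2)\<^sup>2" using l by (simp add: kl norm_power)
      then have k: "norm k = real n + 1/2" by (simp add: power2_eq_iff_nonneg)
      show ?thesis unfolding kl free_solution(2)[OF fs] using n0[OF n k] by simp
    qed
    have "zero_sum N ((real n + 1/2)\<^sup>2) (\<lambda>_. 1) = zero_sum (\<lambda>l. u1 l pi) ((real n + 1/2)\<^sup>2) (\<lambda>_. 1)"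
      by (rule zero_sum_comparison(1)[OF holomorphic_N_D(1) free.holomorphic(2)[OF pi_ge_zero], where e = "1/4"])
         (use * in auto)
    then show ?thesis by (simp only: free_neumann_zero_count[OF fs])
  qed
  then show ?thesis by blast
qed

text \<open>The factor l - W 0 contributes one zero and the value W 0, and N is squared: hence 1
  plus the count for D equals 2 (n + 1), and the sums differ by at most 2 (e' / R) R.\<close>

lemma discriminant_zero_sums:
  assumes e: "0 < e"
  shows "\<exists>n0. \<forall>n\<ge>n0. zero_sum D ((real n + 1/2)\<^sup>2) (\<lambda>_. 1) = of_nat (2 * n + 1) \<and>
     norm (W 0 - (2 * zero_sum N ((real n + 1/2)\<^sup>2) (\<lambda>l. l) - zero_sum D ((real n + 1/2)\<^sup>2) (\<lambda>l. l))) \<le> e"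
proof -
  \<comment> \<open>e / 2 offsets the factor 2 in the comparison; 1/16 keeps e' / R below 1/2, since
    R is at least 1.\<close>
  define e' where "e' = min (e / 2) (1/16)"
  have e': "0 < e'" "e' \<le> e / 2" "e' \<le> 1/16" using e by (auto simp: e'_def)
  obtain n1 where n1: "\<And>n l. n \<ge> n1 \<Longrightarrow> norm l = (real n + 1/2)\<^sup>2 \<Longrightarrow> N l \<noteq> 0 \<and>
     norm ((l - W 0) * D l / (- (N l * N l)) - 1) \<le> e' / norm l"
    using comparison_of_zeros[OF e'(1)] by blast
  obtain n2 where n2: "\<And>n. n \<ge> n2 \<Longrightarrow> zero_sum N ((real n + 1/2)\<^sup>2) (\<lambda>_. 1) = of_nat (Suc n)"
    using neumann_zero_count by blast
  define n0 where "n0 = max (max n1 n2) (nat \<lceil>norm (W 0)\<rceil> + 1)"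
  have "zero_sum D ((real n + 1/2)\<^sup>2) (\<lambda>_. 1) = of_nat (2 * n + 1) \<and>
     norm (W 0 - (2 * zero_sum N ((real n + 1/2)\<^sup>2) (\<lambda>l. l) - zero_sum D ((real n + 1/2)\<^sup>2) (\<lambda>l. l))) \<le> e"
    if n: "n \<ge> n0" for n
  proof -
    define R where "R = (real n + 1/2)\<^sup>2"
    have nn: "n \<ge> n1" "n \<ge> n2" "real n \<ge> norm (W 0)" "n \<ge> 1"
      using n unfolding n0_def by (simp_all, linarith)
    have R: "R > 0" "R \<ge> real n + 1/4"
      by (auto simp: R_def intro!: zero_less_power add_nonneg_pos) (simp add: power2_eq_square algebra_simps)
    have RW: "norm (W 0) < R" and R1: "R \<ge> 1" using R nn by auto
    have q: "N l \<noteq> 0" "norm ((l - W 0) * D l / (- (N l * N l)) - 1) \<le> e' / R" if "norm l = R" for l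
      using n1[OF nn(1), of l] that by (auto simp: R_def)
    have nR: "norm (of_real R :: complex) = R" using R by simp
    have eR: "e' / R < 1/2" using R1 e' by (simp add: divide_less_eq)
    \<comment> \<open>At a zero of D the quotient would be 0, at distance 1 from 1.\<close>
    have "D (of_real R) \<noteq> 0"
    proof
      assume "D (of_real R) = 0"
      then have "1 \<le> e' / R" using q(2)[OF nR] by simp
      then show False using eR by simp
    qed
    note Dn = holomorphic_N_D(2) this and Nn = holomorphic_N_D(1) q(1)[OF nR]
    have lin: "(\<lambda>l. l - W 0) holomorphic_on UNIV" "W 0 + 1 - W 0 \<noteq> 0"
      by (auto intro!: holomorphic_intros)
    have F: "zero_sum (\<lambda>l. (l - W 0) * D l) R g = g (W 0) + zero_sum D R g" for g
      using zero_sum_mult[OF lin Dn] zero_sum_linear[OF RW] by simp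
    have G: "zero_sum (\<lambda>l. - (N l * N l)) R g = 2 * zero_sum N R g" for g
      using zero_sum_mult[OF Nn Nn] by (simp add: zero_sum_uminus)
    note cmp = zero_sum_comparison[of "\<lambda>l. (l - W 0) * D l" "\<lambda>l. - (N l * N l)" R "e' / R", OF _ _ R(1) eR]
    have hol: "(\<lambda>l. (l - W 0) * D l) holomorphic_on UNIV" "(\<lambda>l. - (N l * N l)) holomorphic_on UNIV"
      by (intro holomorphic_intros holomorphic_N_D)+
    have c1: "1 + zero_sum D R (\<lambda>_. 1) = 2 * zero_sum N R (\<lambda>_. 1)"
      using cmp(1)[OF hol] q unfolding F G by simp
    have "zero_sum N R (\<lambda>_. 1) = of_nat (Suc n)" using n2[OF nn(2)] by (simp add: R_def)
    then have "zero_sum D R (\<lambda>_. 1) = of_nat (2 * n + 1)" using c1 by (simp add: algebra_simps)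
    moreover have "norm (W 0 + zero_sum D R (\<lambda>l. l) - 2 * zero_sum N R (\<lambda>l. l)) \<le> 2 * (e' / R) * R"
      using cmp(2)[OF hol] q unfolding F G by simp
    then have "norm (W 0 - (2 * zero_sum N R (\<lambda>l. l) - zero_sum D R (\<lambda>l. l))) \<le> e"
      using R e' by (simp add: algebra_simps)
    ultimately show ?thesis by (simp add: R_def)
  qed
  then show ?thesis by blast
qed

lemma trace_formula_sums:
  assumes E: "zeros_enum D E" and \<nu>: "zeros_enum N \<nu>"
  shows "(\<lambda>m. 2 * \<nu> (Suc m) - E (2 * Suc m - 1) - E (2 * Suc m)) sums (W 0 - (2 * \<nu> 0 - E 0))"
proof -
  obtain n1 where n1: "\<And>n. n \<ge> n1 \<Longrightarrow> zero_sum N ((real n + 1/2)\<^sup>2) (\<lambda>_. 1) = of_nat (Suc n)"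
    using neumann_zero_count by blast
  obtain n2 where n2: "\<And>n. n \<ge> n2 \<Longrightarrow> zero_sum D ((real n + 1/2)\<^sup>2) (\<lambda>_. 1) = of_nat (2 * n + 1)"
    using discriminant_zero_sums[of 1] by auto
  \<comment> \<open>A function vanishing everywhere has an infinite index set on a disc of positive
    radius, so its sum is 0 by convention; a nonzero count excludes it.\<close>
  have nz: "\<exists>b. F b \<noteq> 0" if "zero_sum F R (\<lambda>_. 1) \<noteq> 0" for F R
  proof (rule ccontr)
    assume *: "\<not> (\<exists>b. F b \<noteq> 0)"
    have "R > 0"
    proof (rule ccontr)
      assume "\<not> R > 0"
      then have "{w. norm w < R \<and> F w = 0} = {}" by (auto simp: not_less intro: order_trans dest: less_le_trans[OF _ order_trans])
      then show False using that by (simp only: zero_sum_def sum.empty)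
    qed
    then have "ball 0 R \<subseteq> {w. norm w < R \<and> F w = 0}" using * by auto
    moreover have "infinite (ball (0::complex) R)" using \<open>R > 0\<close> by (meson countable_finite uncountable_ball)
    ultimately have "infinite {w. norm w < R \<and> F w = 0}" by (meson finite_subset)
    then show False using that by (simp add: zero_sum_def)
  qed
  obtain bN where bN: "N bN \<noteq> 0" using nz[of N] n1[of n1] by (metis le_refl nat.distinct(1) of_nat_eq_0_iff)
  obtain bD where bD: "D bD \<noteq> 0" using nz[of D] n2[of n2] by (metis Suc_eq_plus1 le_refl nat.distinct(1) of_nat_eq_0_iff)
  have sN: "(\<Sum>m<Suc n. \<nu> m) = zero_sum N ((real n + 1/2)\<^sup>2) (\<lambda>l. l)" if "n \<ge> n1" for n
    using zeros_enum_partial_sum[OF \<nu> holomorphic_N_D(1) bN unbounded_zeros[of n1 N Suc] n1[OF that]] n1 by simp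
  have sD: "(\<Sum>m<2 * n + 1. E m) = zero_sum D ((real n + 1/2)\<^sup>2) (\<lambda>l. l)" if "n \<ge> n2" for n
    using zeros_enum_partial_sum[OF E holomorphic_N_D(2) bD unbounded_zeros[of n2 D "\<lambda>n. 2 * n + 1"] n2[OF that]] n2 by simp
  \<comment> \<open>With the term 2 \<nu>_0 - E_0 restored, n summands involve \<nu> up to index n
    and E up to index 2 n: n + 1 and 2 n + 1 numbers, exactly as many as the n-th disc
    contains.\<close>
  have ps: "(\<Sum>m<n. 2 * \<nu> (Suc m) - E (2 * Suc m - 1) - E (2 * Suc m))
     = 2 * (\<Sum>m<Suc n. \<nu> m) - (\<Sum>m<2 * n + 1. E m) - (2 * \<nu> 0 - E 0)" for n
    by (induction n) (simp_all add: algebra_simps)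
  show ?thesis
    unfolding sums_def
  proof (rule LIMSEQ_I)
    fix r :: real assume r: "r > 0"
    obtain n3 where n3: "\<And>n. n \<ge> n3 \<Longrightarrow>
      norm (W 0 - (2 * zero_sum N ((real n + 1/2)\<^sup>2) (\<lambda>l. l) - zero_sum D ((real n + 1/2)\<^sup>2) (\<lambda>l. l))) \<le> r / 2"
      using discriminant_zero_sums[of "r / 2"] r by auto
    show "\<exists>no. \<forall>n\<ge>no. norm ((\<Sum>m<n. 2 * \<nu> (Suc m) - E (2 * Suc m - 1) - E (2 * Suc m)) - (W 0 - (2 * \<nu> 0 - E 0))) < r"
    proof (intro exI[of _ "max n1 (max n2 n3)"] allI impI)
      fix n assume "n \<ge> max n1 (max n2 n3)"
      then have n: "n \<ge> n1" "n \<ge> n2" "n \<ge> n3" by auto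
      have "norm ((\<Sum>m<n. 2 * \<nu> (Suc m) - E (2 * Suc m - 1) - E (2 * Suc m)) - (W 0 - (2 * \<nu> 0 - E 0)))
        = norm (W 0 - (2 * zero_sum N ((real n + 1/2)\<^sup>2) (\<lambda>l. l) - zero_sum D ((real n + 1/2)\<^sup>2) (\<lambda>l. l)))"
        unfolding ps sN[OF n(1)] sD[OF n(2)] by (subst norm_minus_commute) (simp add: algebra_simps)
      then show "norm ((\<Sum>m<n. 2 * \<nu> (Suc m) - E (2 * Suc m - 1) - E (2 * Suc m)) - (W 0 - (2 * \<nu> 0 - E 0))) < r"
        using n3[OF n(3)] r by simp
    qed
  qed
qed

end

theorem theorem3p2:
  fixes V :: "real \<Rightarrow> complex" and E :: "nat \<Rightarrow> complex"
    and \<nu> :: "nat \<Rightarrow> complex" and x :: real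
  assumes "V C1_differentiable_on UNIV"
    and "\<forall>t. V (t + pi) = V t"
    and "zeros_enum (\<lambda>lam. (discr V lam)\<^sup>2 - 1) E"
    and "zeros_enum (neumann_fun V x) \<nu>"
  shows "summable (\<lambda>m. 2 * \<nu> (Suc m) - E (2 * Suc m - 1) - E (2 * Suc m))
    \<and> V x = 2 * \<nu> 0 - E 0 + (\<Sum>m. 2 * \<nu> (Suc m) - E (2 * Suc m - 1) - E (2 * Suc m))"
proof -
  obtain V' where V': "\<And>t. (V has_vector_derivative V' t) (at t)" "continuous_on UNIV V'"
    using assms(1) by (auto simp: C1_differentiable_on_def)
  have V: "continuous_on UNIV V"
    by (meson V'(1) continuous_at_imp_continuous_on has_vector_derivative_continuous)
  interpret fundamental_system "\<lambda>t. V (t + x)"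
    "\<lambda>l t. csol V l x (t + x)" "\<lambda>l t. vector_derivative (csol V l x) (at (t + x))"
    "\<lambda>l t. ssol V l x (t + x)" "\<lambda>l t. vector_derivative (ssol V l x) (at (t + x))"
    by (rule fundamental_system_csol_ssol[OF V])
  interpret hill_system "\<lambda>t. V (t + x)"
    "\<lambda>l t. csol V l x (t + x)" "\<lambda>l t. vector_derivative (csol V l x) (at (t + x))"
    "\<lambda>l t. ssol V l x (t + x)" "\<lambda>l t. vector_derivative (ssol V l x) (at (t + x))" "\<lambda>t. V' (t + x)"
  proof
    show "((\<lambda>t. V (t + x)) has_vector_derivative V' (t + x)) (at t)" for t
      by (rule has_vector_derivative_shift[OF V'(1)])
    show "continuous_on UNIV (\<lambda>t. V' (t + x))"
      by (intro continuous_on_compose2[OF V'(2)] continuous_intros) auto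
    show "V (pi + x) = V (0 + x)" using spec[OF assms(2), of x] by (simp add: add.commute)
  qed
  have "N = neumann_fun V x"
    by (simp add: fun_eq_iff N_def neumann_fun_def add.commute)
  \<comment> \<open>\<open>D\<close> is built at the base point x, whereas \<open>discr\<close> is
    defined at 0; independence of the base point bridges the two.\<close>
  moreover have "D = (\<lambda>lam. (discr V lam)\<^sup>2 - 1)"
    by (simp add: fun_eq_iff D_def discr_base_point[OF V assms(2), of _ x] add.commute)
  ultimately have "(\<lambda>m. 2 * \<nu> (Suc m) - E (2 * Suc m - 1) - E (2 * Suc m)) sums (V x - (2 * \<nu> 0 - E 0))"
    using trace_formula_sums[of E \<nu>] assms(3,4) by simp
  then show ?thesis by (simp add: sums_iff)
qed

end
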